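(* For every odd prime power $q$, there exists a connected worthy semi-symmetric graph of order $2(q^3+q^2+q+1)$ with valency $q^3+q^2$. In particular, writing the order as $2n$ and the valency as $d$, the ratio $d/n=(q^3+q^2)/(q^3+q^2+q+1)$, which tends to $1$ as $q\to\infty$.
   Context: All graphs are simple and undirected. A graph is semi-symmetric if it is regular and edge-transitive (its automorphism group is transitive on edges) but not vertex-transitive. A graph is worthy if no two distinct vertices have the same neighbourhood. *)

theory Defs
  imports Complex_Main "HOL-Number_Theory.Prime_Powers" "Graph_Theory.Graph_Theory"
begin

text \<open>
  A finite simple undirected graph is a \<^locale>\<open>pair_graph\<close> of the AFP entry Graph_Theory:
  finitely many vertices and a symmetric irreflexive set of arcs, so that the undirected edge
  joining \<open>u\<close> and \<open>v\<close> is represented by the two arcs \<open>(u, v)\<close> and \<open>(v, u)\<close>.  The definitions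
  below are meant for such graphs only.
\<close>

definition edges :: "'a pair_pre_digraph \<Rightarrow> 'a set set" where
  "edges G = {{u, v} | u v. (u, v) \<in> parcs G}"

definition neighbourhood :: "'a pair_pre_digraph \<Rightarrow> 'a \<Rightarrow> 'a set" where
  "neighbourhood G v = {u. (v, u) \<in> parcs G}"

definition regular :: "'a pair_pre_digraph \<Rightarrow> nat \<Rightarrow> bool" where
  "regular G d \<longleftrightarrow> (\<forall>v \<in> pverts G. card (neighbourhood G v) = d)"

definition worthy :: "'a pair_pre_digraph \<Rightarrow> bool" where
  "worthy G \<longleftrightarrow>
     (\<forall>u \<in> pverts G. \<forall>v \<in> pverts G. u \<noteq> v \<longrightarrow> neighbourhood G u \<noteq> neighbourhood G v)"

text \<open>The values of \<open>f\<close> outside the vertex set are irrelevant.\<close>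

definition automorphism :: "'a pair_pre_digraph \<Rightarrow> ('a \<Rightarrow> 'a) \<Rightarrow> bool" where
  "automorphism G f \<longleftrightarrow>
     bij_betw f (pverts G) (pverts G) \<and>
     (\<forall>u \<in> pverts G. \<forall>v \<in> pverts G. (f u, f v) \<in> parcs G \<longleftrightarrow> (u, v) \<in> parcs G)"

definition vertex_transitive :: "'a pair_pre_digraph \<Rightarrow> bool" where
  "vertex_transitive G \<longleftrightarrow>
     (\<forall>u \<in> pverts G. \<forall>v \<in> pverts G. \<exists>f. automorphism G f \<and> f u = v)"

text \<open>Transitivity on undirected edges: an edge may be mapped to another with either orientation.\<close>

definition edge_transitive :: "'a pair_pre_digraph \<Rightarrow> bool" where
  "edge_transitive G \<longleftrightarrow> (\<forall>e \<in> edges G. \<forall>e' \<in> edges G. \<exists>f. automorphism G f \<and> f ` e = e')"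

definition semi_symmetric :: "'a pair_pre_digraph \<Rightarrow> bool" where
  "semi_symmetric G \<longleftrightarrow> (\<exists>d. regular G d) \<and> edge_transitive G \<and> \<not> vertex_transitive G"

end

theory Submission
  imports "HOL-Algebra.Algebraic_Closure" "HOL-Number_Theory.Residues" "HOL-Real_Asymp.Real_Asymp" Defs
begin

text \<open>
  The graph is the bipartite non-incidence graph of the symplectic generalized quadrangle \<open>W(q)\<close>:
  its vertices are the points of the projective three-space over the field with \<open>q\<close> elements and the
  lines that are totally isotropic for a symplectic form.  Since every antiflag extends to a
  symplectic basis, the symplectic group is transitive on edges.  An automorphism exchanging a
  point with a line would be a duality of \<open>W(q)\<close>.  There is none for odd \<open>q\<close>: a point collinear
  with two points of \<open>{x, y}\<^sup>\<bottom>\<close> (\<open>x, y\<close> not collinear) is collinear with all of them, but the dual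
  statement fails for an explicit configuration of six lines unless \<open>2 = 0\<close>.
\<close>

section \<open>Finite fields of prime power order\<close>

text \<open>Why non-incidence: \<open>W(q)\<close> has
  \<open>(q + 1)(q^2 + 1) = q^3 + q^2 + q + 1\<close> points and as many lines, and every point or
  line is incident with only \<open>q + 1\<close> objects of the other kind. The incidence graph is
  therefore sparse, while in its bipartite complement every vertex sees \<open>q^3 + q^2\<close> of
  the other class, nearly all of it. Since both classes have the same size and the same valency, no
  count can tell points from lines; vertex-transitivity has to be refuted by structure. An
  automorphism taking one point to a line must exchange the two classes entirely, because any two
  points have a common neighbour, and then it is a duality. The field is only a subset of a ring, so
  dimension theory is replaced by two devices: coordinates with respect to a symplectic basis are
  read off by the form, and spaces of equal finite cardinality, one inside the other,
  coincide.\<close>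

lemma (in cring) binomial_theorem:
  assumes x: "x \<in> carrier R" and y: "y \<in> carrier R"
  shows "(x \<oplus> y) [^] (n::nat) = (\<Oplus>k\<in>{..n}. [(n choose k)] \<cdot> (x [^] k \<otimes> y [^] (n - k)))"
proof (induction n)
  case 0
  show ?case using x y by simp
next
  case (Suc n)
  let ?A = "\<lambda>k. [(n choose k)] \<cdot> (x [^] Suc k \<otimes> y [^] (n - k))"
  let ?B = "\<lambda>k. [(n choose k)] \<cdot> (x [^] k \<otimes> y [^] (Suc n - k))"
  let ?C = "\<lambda>k. [(Suc n choose k)] \<cdot> (x [^] k \<otimes> y [^] (Suc n - k))"
  have cl: "[m] \<cdot> (x [^] k \<otimes> y [^] l) \<in> carrier R" for m k l :: nat
    using x y by simp
  have A: "(\<Oplus>k\<in>{..n}. [(n choose k)] \<cdot> (x [^] k \<otimes> y [^] (n - k))) \<otimes> x = (\<Oplus>k\<in>{..n}. ?A k)"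
  proof -
    have "(\<Oplus>k\<in>{..n}. [(n choose k)] \<cdot> (x [^] k \<otimes> y [^] (n - k))) \<otimes> x
        = (\<Oplus>k\<in>{..n}. [(n choose k)] \<cdot> (x [^] k \<otimes> y [^] (n - k)) \<otimes> x)"
      using cl x by (intro finsum_ldistr) auto
    also have "\<dots> = (\<Oplus>k\<in>{..n}. ?A k)"
      using x y by (intro finsum_cong') (auto simp: add_pow_ldistr add_pow_rdistr m_ac)
    finally show ?thesis .
  qed
  have B: "(\<Oplus>k\<in>{..n}. [(n choose k)] \<cdot> (x [^] k \<otimes> y [^] (n - k))) \<otimes> y = (\<Oplus>k\<in>{..n}. ?B k)"
  proof -
    have "(\<Oplus>k\<in>{..n}. [(n choose k)] \<cdot> (x [^] k \<otimes> y [^] (n - k))) \<otimes> y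
        = (\<Oplus>k\<in>{..n}. [(n choose k)] \<cdot> (x [^] k \<otimes> y [^] (n - k)) \<otimes> y)"
      using cl y by (intro finsum_ldistr) auto
    also have "\<dots> = (\<Oplus>k\<in>{..n}. ?B k)"
      using x y by (intro finsum_cong') (auto simp: add_pow_ldistr m_ac add_pow_rdistr Suc_diff_le)
    finally show ?thesis .
  qed
  have "(\<Oplus>k\<in>{..Suc n}. ?B k) = ?B (Suc n) \<oplus> (\<Oplus>k\<in>{..n}. ?B k)"
    by (rule finsum_Suc) (use x y in auto)
  also have "\<dots> = (\<Oplus>k\<in>{..n}. ?B k)"
    using x y by (simp add: Pi_def binomial_eq_0)
  finally have B': "(\<Oplus>k\<in>{..Suc n}. ?B k) = (\<Oplus>k\<in>{..n}. ?B k)" .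
  have B'': "(\<Oplus>k\<in>{..Suc n}. ?B k) = (\<Oplus>k\<in>{..n}. ?B (Suc k)) \<oplus> ?B 0"
    by (rule finsum_Suc2) (use x y in auto)
  have "(\<Oplus>k\<in>{..Suc n}. ?C k) = (\<Oplus>k\<in>{..n}. ?C (Suc k)) \<oplus> ?C 0"
    by (rule finsum_Suc2) (use x y in auto)
  also have "(\<Oplus>k\<in>{..n}. ?C (Suc k)) = (\<Oplus>k\<in>{..n}. ?A k \<oplus> ?B (Suc k))"
    using x y by (intro finsum_cong') (auto simp: add.nat_pow_mult)
  also have "\<dots> = (\<Oplus>k\<in>{..n}. ?A k) \<oplus> (\<Oplus>k\<in>{..n}. ?B (Suc k))"
    by (rule finsum_addf) (use x y in auto)
  also have "\<dots> \<oplus> ?C 0 = (\<Oplus>k\<in>{..n}. ?A k) \<oplus> ((\<Oplus>k\<in>{..n}. ?B (Suc k)) \<oplus> ?B 0)"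
    using x y by (subst a_assoc) (auto intro!: finsum_closed)
  also have "\<dots> = (\<Oplus>k\<in>{..n}. ?A k) \<oplus> (\<Oplus>k\<in>{..n}. ?B k)"
    using B' B'' by simp
  also have "\<dots> = (\<Oplus>k\<in>{..n}. [(n choose k)] \<cdot> (x [^] k \<otimes> y [^] (n - k))) \<otimes> (x \<oplus> y)"
    unfolding A [symmetric] B [symmetric] using cl x y by (intro r_distr [symmetric]) auto
  also have "\<dots> = (x \<oplus> y) [^] Suc n"
    by (simp add: Suc.IH)
  finally show ?case by simp
qed

lemma (in cring) freshmans_dream:
  assumes p: "prime (p::nat)" and char: "[p] \<cdot> \<one> = \<zero>"
    and x: "x \<in> carrier R" and y: "y \<in> carrier R"
  shows "(x \<oplus> y) [^] p = x [^] p \<oplus> y [^] p"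
proof -
  let ?f = "\<lambda>k. [(p choose k)] \<cdot> (x [^] k \<otimes> y [^] (p - k))"
  have char': "[p] \<cdot> z = \<zero>" if "z \<in> carrier R" for z
    using add_pow_ldistr[of \<one> z p] that char by simp
  have cl: "?f k \<in> carrier R" for k
    using x y by simp
  have zero: "?f k = \<zero>" if "k \<in> {0<..<p}" for k
  proof -
    have "p dvd (p choose k)"
      using that p by (intro dvd_choose_prime) auto
    then obtain m where "p choose k = p * m" ..
    then have "?f k = [m] \<cdot> ([p] \<cdot> (x [^] k \<otimes> y [^] (p - k)))"
      using x y by (simp add: add.nat_pow_pow)
    then show ?thesis
      using x y char' by simp
  qed
  have "{..p} = insert 0 (insert p {0<..<p})" and "p > 0"
    using prime_gt_0_nat[OF p] by auto
  moreover have "(\<Oplus>k\<in>insert p {0<..<p}. ?f k) = ?f p \<oplus> (\<Oplus>k\<in>{0<..<p}. ?f k)"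
    by (intro finsum_insert Pi_I cl) auto
  moreover have "(\<Oplus>k\<in>insert 0 (insert p {0<..<p}). ?f k) = ?f 0 \<oplus> (\<Oplus>k\<in>insert p {0<..<p}. ?f k)"
    by (intro finsum_insert Pi_I cl) (use \<open>p > 0\<close> in auto)
  ultimately have "(\<Oplus>k\<in>{..p}. ?f k) = ?f 0 \<oplus> (?f p \<oplus> (\<Oplus>k\<in>{0<..<p}. ?f k))"
    by simp
  also have "(\<Oplus>k\<in>{0<..<p}. ?f k) = (\<Oplus>k\<in>{0<..<p}. \<zero>)"
    using zero by (intro finsum_cong') auto
  finally show ?thesis
    using x y by (simp add: binomial_theorem a_comm)
qed

text \<open>Used in two rings: in an algebraically closed \<open>L\<close>, where it makes the
  solutions of \<open>x^q = x\<close> closed under addition, and in the polynomial ring over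
  \<open>L\<close>, where it shows that the roots of \<open>X^q - X\<close> are simple.\<close>

lemma (in cring) freshmans_dream_prime_power:
  assumes "prime (p::nat)" and "[p] \<cdot> \<one> = \<zero>" and "x \<in> carrier R" and "y \<in> carrier R"
  shows "(x \<oplus> y) [^] (p ^ n) = x [^] (p ^ n) \<oplus> y [^] (p ^ n)"
proof (induction n)
  case 0
  show ?case using assms by simp
next
  case (Suc n)
  have *: "z [^] (p ^ Suc n) = (z [^] (p ^ n)) [^] p" if "z \<in> carrier R" for z
    using that by (simp add: nat_pow_pow mult.commute)
  show ?case
    using assms by (simp add: * Suc freshmans_dream del: power_Suc)
qed


section \<open>Algebraic closures in characteristic \<open>p\<close> and the roots of
  \<open>X^q - X\<close>\<close>

lemma residue_ring_char:
  assumes "prime (p::nat)"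
  shows "[p] \<cdot>\<^bsub>residue_ring (int p)\<^esub> \<one>\<^bsub>residue_ring (int p)\<^esub> = \<zero>\<^bsub>residue_ring (int p)\<^esub>"
proof -
  interpret residues_prime p "residue_ring (int p)"
    using assms by unfold_locales simp_all
  have "[k] \<cdot>\<^bsub>residue_ring (int p)\<^esub> \<one>\<^bsub>residue_ring (int p)\<^esub> = int k mod int p" for k :: nat
    by (induction k) (auto simp: res_zero_eq res_one_eq res_add_eq mod_simps ac_simps)
  then show ?thesis
    by (simp add: res_zero_eq)
qed

text \<open>The closure of the residue ring modulo \<open>p\<close> contains the fields with
  \<open>p^n\<close> elements for all \<open>n > 0\<close>. The carrier type is the one that
  \<open>alg_closure\<close> yields over a ring on \<open>int\<close>.\<close>

lemma ex_alg_closed_field_char: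
  assumes p: "prime (p::nat)"
  shows "\<exists>L :: ((int list \<times> nat) multiset \<Rightarrow> int) ring. algebraically_closed L \<and> [p] \<cdot>\<^bsub>L\<^esub> \<one>\<^bsub>L\<^esub> = \<zero>\<^bsub>L\<^esub>"
proof -
  let ?R = "residue_ring (int p)"
  interpret R: residues_prime p ?R
    using p by unfold_locales simp_all
  let ?L = "R.alg_closure"
  interpret L: algebraic_closure ?L "R.indexed_const ` carrier ?R"
    by (rule R.alg_closureE)
  interpret h: ring_hom_ring ?R ?L R.indexed_const
    by (intro ring_hom_ringI2 R.ring_axioms L.ring_axioms R.alg_closureE)
  have "R.indexed_const ([k] \<cdot>\<^bsub>?R\<^esub> \<one>\<^bsub>?R\<^esub>) = [k] \<cdot>\<^bsub>?L\<^esub> \<one>\<^bsub>?L\<^esub>" for k :: nat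
    by (induction k) auto
  from this[of p] have "[p] \<cdot>\<^bsub>?L\<^esub> \<one>\<^bsub>?L\<^esub> = \<zero>\<^bsub>?L\<^esub>"
    by (simp add: residue_ring_char p)
  then show ?thesis
    using L.algebraically_closed_axioms by blast
qed

text \<open>\<open>L\<close> splits \<open>X^q - X\<close>, so the multiset of its roots has size
  \<open>q\<close>; here \<open>n > 0\<close> gives \<open>q > 1\<close>, which keeps the degree at
  \<open>q\<close>. It remains to exclude repeated roots, by a factorization instead of a
  derivative.\<close>

lemma (in algebraically_closed) roots_of_frobenius:
  assumes p: "prime (p::nat)" and char: "[p] \<cdot> \<one> = \<zero>" and n: "n > 0"
  shows "card {x \<in> carrier L. x [^] (p ^ n) = x} = p ^ n"
    and "finite {x \<in> carrier L. x [^] (p ^ n) = x}"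
proof -
  let ?q = "p ^ n"
  let ?P = "poly_ring L"
  have q: "?q > 1" using p n by (metis one_less_power prime_gt_1_nat)
  interpret UP: domain ?P
    using univ_poly_is_domain[OF carrier_is_subring] .
  have X: "X \<in> carrier ?P" by (rule var_closed[OF carrier_is_subring])
  have XX: "X [^]\<^bsub>?P\<^esub> k \<in> carrier ?P" for k :: nat using X by simp
  define f where "f = X [^]\<^bsub>?P\<^esub> ?q \<ominus>\<^bsub>?P\<^esub> X"
  have f: "f \<in> carrier ?P" using X by (simp add: f_def)
  have ev_mult: "eval (u \<otimes>\<^bsub>?P\<^esub> v) a = eval u a \<otimes> eval v a"
    and ev_one: "eval \<one>\<^bsub>?P\<^esub> a = \<one>"
    if "u \<in> carrier ?P" "v \<in> carrier ?P" "a \<in> carrier L" for u v a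
    using that ring_hom_memE[OF eval_is_hom[OF carrier_is_subring that(3)]] by auto
  have ev_pow: "eval (u [^]\<^bsub>?P\<^esub> k) a = eval u a [^] k" if "u \<in> carrier ?P" "a \<in> carrier L" for u a and k :: nat
    using that by (induction k) (auto simp: ev_one[of u u] ev_mult)
  have ev_minus: "eval (u \<ominus>\<^bsub>?P\<^esub> v) a = eval u a \<ominus> eval v a"
    if "u \<in> carrier ?P" "v \<in> carrier ?P" "a \<in> carrier L" for u v a
  proof -
    interpret h: ring_hom_ring ?P L "\<lambda>u. eval u a"
      by (rule eval_ring_hom[OF carrier_is_subring that(3)])
    show ?thesis using that by (simp add: a_minus_def)
  qed
  have ev_f: "eval f a = a [^] ?q \<ominus> a" if "a \<in> carrier L" for a
    using that X by (simp add: f_def ev_minus ev_pow eval_var)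
  have deg: "degree f = ?q"
  proof -
    have "\<ominus>\<^bsub>?P\<^esub> X \<in> carrier ?P" using X by simp
    have dX: "degree (\<ominus>\<^bsub>?P\<^esub> X) = 1"
      using univ_poly_a_inv_degree[OF carrier_is_subring X] by (simp add: var_def)
    have dq: "degree (X [^]\<^bsub>?P\<^esub> ?q) = ?q"
      unfolding unitary_monom_eq_var_pow[OF carrier_is_subring, symmetric] by (simp add: monom_def)
    have "degree (poly_add (X [^]\<^bsub>?P\<^esub> ?q) (\<ominus>\<^bsub>?P\<^esub> X)) = max (degree (X [^]\<^bsub>?P\<^esub> ?q)) (degree (\<ominus>\<^bsub>?P\<^esub> X))"
      using XX X q n dX dq by (intro poly_add_degree_eq[OF carrier_is_subring]) (auto simp: univ_poly_carrier)
    then show ?thesis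
      using q dX dq by (simp add: f_def a_minus_def univ_poly_add)
  qed
  have "splitted f" using f by (rule roots_over_carrier)
  then have sz: "size (roots f) = ?q" using deg by (simp add: splitted_def)
  have ne: "f \<noteq> []" using deg q by (metis One_nat_def Suc_lessD length_0_conv less_numeral_extra(3) list.size(3) zero_diff)
  \<comment> \<open>Lets the Frobenius identity be applied to \<open>X = (X - a) + a\<close> among
    polynomials.\<close>
  have char': "[p] \<cdot>\<^bsub>?P\<^esub> \<one>\<^bsub>?P\<^esub> = \<zero>\<^bsub>?P\<^esub>"
  proof -
    interpret h: ring_hom_ring "L\<lparr>carrier := carrier L\<rparr>" ?P poly_of_const
      by (rule canonical_embedding_ring_hom[OF carrier_is_subring])
    have "poly_of_const ([k] \<cdot> \<one>) = [k] \<cdot>\<^bsub>?P\<^esub> \<one>\<^bsub>?P\<^esub>" for k :: nat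
      using h.hom_one h.hom_add h.hom_zero by (induction k) auto
    from this[of p] show ?thesis
      using h.hom_zero char by simp
  qed
  \<comment> \<open>If \<open>a\<close> is a root, then \<open>f = (X - a) ^ q - (X - a) = (X - a) * ((X - a) ^ (q - 1) - 1)\<close>, and the
      second factor does not vanish at \<open>a\<close>.\<close>
  have simple: "count (roots f) a \<le> 1" for a
  proof (rule ccontr)
    assume "\<not> count (roots f) a \<le> 1"
    then have c: "2 \<le> count (roots f) a" by simp
    then have "a \<in># roots f" by (metis count_greater_zero_iff less_le_trans zero_less_numeral)
    then have "is_root f a" using roots_mem_iff_is_root[OF f] by simp
    then have a: "a \<in> carrier L" and aq: "a [^] ?q = a"
      using ev_f unfolding is_root_def by auto
    let ?D = "[\<one>, \<ominus> a]" and ?C = "poly_of_const a"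
    interpret h: ring_hom_ring L ?P poly_of_const
      using canonical_embedding_ring_hom[OF carrier_is_subring] by simp
    have C: "?C \<in> carrier ?P" using a by simp
    have D: "?D \<in> carrier ?P" using a by (simp add: univ_poly_def polynomial_def)
    have D0: "?D \<noteq> \<zero>\<^bsub>?P\<^esub>" by (simp add: univ_poly_zero)
    have evD: "eval ?D a = \<zero>" using a by (simp add: r_neg)
    have DC: "?D \<oplus>\<^bsub>?P\<^esub> ?C = X"
      using a by (auto simp: univ_poly_add poly_of_const_def var_def l_neg)
    have Cq: "?C [^]\<^bsub>?P\<^esub> ?q = ?C"
      using aq a by (metis h.hom_nat_pow)
    have "f = (?D [^]\<^bsub>?P\<^esub> ?q \<oplus>\<^bsub>?P\<^esub> ?C) \<ominus>\<^bsub>?P\<^esub> (?D \<oplus>\<^bsub>?P\<^esub> ?C)"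
      unfolding f_def DC [symmetric] UP.freshmans_dream_prime_power[OF p char' D C] Cq ..
    also have "\<dots> = ?D [^]\<^bsub>?P\<^esub> ?q \<ominus>\<^bsub>?P\<^esub> ?D"
      using C D UP.nat_pow_closed[OF D, of ?q] by algebra
    \<comment> \<open>Two successors because \<open>q > 1\<close>: the second factor is
      \<open>(X - a) ^ Suc m - 1\<close>, with a positive exponent, and so takes the value
      \<open>- 1\<close> at \<open>a\<close>.\<close>
    also obtain m where m: "?q = Suc (Suc m)"
      using less_imp_Suc_add[OF q] by auto
    have "?D [^]\<^bsub>?P\<^esub> ?q \<ominus>\<^bsub>?P\<^esub> ?D = ?D [^]\<^bsub>?P\<^esub> Suc (Suc m) \<ominus>\<^bsub>?P\<^esub> ?D"
      unfolding m ..
    also have "?D [^]\<^bsub>?P\<^esub> Suc (Suc m) \<ominus>\<^bsub>?P\<^esub> ?D = ?D \<otimes>\<^bsub>?P\<^esub> (?D [^]\<^bsub>?P\<^esub> Suc m \<ominus>\<^bsub>?P\<^esub> \<one>\<^bsub>?P\<^esub>)"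
      unfolding UP.nat_pow_Suc2[OF D, of "Suc m"] a_minus_def
      using D UP.nat_pow_closed[OF D, of "Suc m"]
      by (simp only: UP.r_distr UP.r_minus UP.r_one UP.one_closed UP.add.inv_closed)
    finally have f1: "f = ?D \<otimes>\<^bsub>?P\<^esub> (?D [^]\<^bsub>?P\<^esub> Suc m \<ominus>\<^bsub>?P\<^esub> \<one>\<^bsub>?P\<^esub>)" .
    \<comment> \<open>A repeated root would leave a factor \<open>X - a\<close> in the second factor
      after cancelling the first; evaluation at \<open>a\<close> then gives
      \<open>- 1 = 0\<close>.\<close>
    have "(?D [^]\<^bsub>?P\<^esub> (2::nat)) pdivides f"
      using c by (intro le_alg_mult_imp_pdivides[OF a f]) (simp add: alg_mult_eq_count_roots[OF f])
    then obtain r where r: "r \<in> carrier ?P" "f = ?D [^]\<^bsub>?P\<^esub> (2::nat) \<otimes>\<^bsub>?P\<^esub> r"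
      unfolding pdivides_def factor_def by blast
    then have "f = ?D \<otimes>\<^bsub>?P\<^esub> (?D \<otimes>\<^bsub>?P\<^esub> r)"
      using D by (simp add: numeral_2_eq_2 UP.m_assoc)
    with f1 have "?D [^]\<^bsub>?P\<^esub> Suc m \<ominus>\<^bsub>?P\<^esub> \<one>\<^bsub>?P\<^esub> = ?D \<otimes>\<^bsub>?P\<^esub> r"
      using D D0 r(1) by (metis UP.m_lcancel UP.m_closed UP.nat_pow_closed UP.minus_closed UP.one_closed)
    then have "eval (?D [^]\<^bsub>?P\<^esub> Suc m \<ominus>\<^bsub>?P\<^esub> \<one>\<^bsub>?P\<^esub>) a = eval (?D \<otimes>\<^bsub>?P\<^esub> r) a"
      by (rule arg_cong)
    moreover have "eval (?D [^]\<^bsub>?P\<^esub> Suc m \<ominus>\<^bsub>?P\<^esub> \<one>\<^bsub>?P\<^esub>) a = \<zero> [^] Suc m \<ominus> \<one>"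
      using D a evD by (simp only: ev_minus UP.nat_pow_closed UP.one_closed ev_pow ev_one[OF D D])
    moreover have "eval (?D \<otimes>\<^bsub>?P\<^esub> r) a = \<zero>"
      using D r(1) a evD ring_hom_memE(1)[OF eval_is_hom[OF carrier_is_subring a] r(1)]
      by (simp only: ev_mult l_null)
    ultimately have "\<ominus> \<one> = \<zero>"
      by (simp add: a_minus_def)
    then have "\<one> = \<zero>"
      using minus_minus[OF one_closed] minus_zero by simp
    then show False
      using one_not_zero by contradiction
  qed
  show "card {x \<in> carrier L. x [^] ?q = x} = ?q"  and "finite {x \<in> carrier L. x [^] (p ^ n) = x}"
  proof -
    have S: "set_mset (roots f) = {x \<in> carrier L. x [^] ?q = x}"
      using roots_mem_iff_is_root[OF f] ev_f ne by (auto simp: is_root_def)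
    have *: "roots f = mset_set (set_mset (roots f))"
    proof (rule multiset_eqI)
      fix x
      show "count (roots f) x = count (mset_set (set_mset (roots f))) x"
        using simple[of x] by (auto simp: count_mset_set' simp flip: count_greater_zero_iff)
    qed
    have "card (set_mset (roots f)) = size (roots f)"
      by (subst (2) *) simp
    then show "card {x \<in> carrier L. x [^] ?q = x} = ?q"
      using sz S by simp
    show "finite {x \<in> carrier L. x [^] (p ^ n) = x}"
      unfolding S [symmetric] by simp
  qed
qed

text \<open>The fixed points of the \<open>q\<close>-th power map on an algebraically closed field
  of characteristic \<open>p\<close> form a subfield. Being finite, it can be copied into
  \<open>nat\<close>, which gives the fields of all orders one simple carrier type.\<close>

theorem ex_field_of_primepow_order:
  assumes "primepow (q::nat)"
  shows "\<exists>R :: nat ring. field R \<and> card (carrier R) = q"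
proof -
  obtain p n where p: "prime p" and n: "n > 0" and q: "q = p ^ n"
    using assms unfolding primepow_def by blast
  obtain L :: "((int list \<times> nat) multiset \<Rightarrow> int) ring"
    where L: "algebraically_closed L" and char: "[p] \<cdot>\<^bsub>L\<^esub> \<one>\<^bsub>L\<^esub> = \<zero>\<^bsub>L\<^esub>"
    using ex_alg_closed_field_char[OF p] by blast
  interpret algebraically_closed L by (rule L)
  let ?S = "{x \<in> carrier L. x [^]\<^bsub>L\<^esub> q = x}"
  have card: "card ?S = q" and fin: "finite ?S"
    using roots_of_frobenius[OF p char n] by (auto simp: q)
  have q0: "q > 0" using assms by (simp add: primepow_gt_0_nat)
  have add: "(x \<oplus>\<^bsub>L\<^esub> y) [^]\<^bsub>L\<^esub> q = x [^]\<^bsub>L\<^esub> q \<oplus>\<^bsub>L\<^esub> y [^]\<^bsub>L\<^esub> q" if "x \<in> carrier L" "y \<in> carrier L" for x y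
    unfolding q by (rule freshmans_dream_prime_power[OF p char that])
  have "subring ?S L"
  proof (rule ring.subringI)
    \<comment> \<open>Additivity of the \<open>q\<close>-th power at \<open>x + (- x) = 0\<close>
      determines the power of \<open>- x\<close> without a case distinction on the parity of
      \<open>q\<close>.\<close>
    fix x assume x: "x \<in> ?S"
    have "\<zero>\<^bsub>L\<^esub> = (x \<oplus>\<^bsub>L\<^esub> \<ominus>\<^bsub>L\<^esub> x) [^]\<^bsub>L\<^esub> q"
      using x q0 by (simp add: r_neg nat_pow_zero)
    also have "\<dots> = x \<oplus>\<^bsub>L\<^esub> (\<ominus>\<^bsub>L\<^esub> x) [^]\<^bsub>L\<^esub> q"
      using x by (subst add) auto
    finally have "\<ominus>\<^bsub>L\<^esub> x = (\<ominus>\<^bsub>L\<^esub> x) [^]\<^bsub>L\<^esub> q"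
      using x by (intro minus_equality) (auto simp: a_comm)
    then show "\<ominus>\<^bsub>L\<^esub> x \<in> ?S"
      using x by auto
  qed (auto simp: ring_axioms add nat_pow_distrib)
  then have "subfield ?S L"
  proof (rule subfieldI')
    fix k assume k: "k \<in> ?S - {\<zero>\<^bsub>L\<^esub>}"
    then have "k \<in> Units L" by (simp add: field_Units)
    then have "k \<otimes>\<^bsub>L\<^esub> inv\<^bsub>L\<^esub> k [^]\<^bsub>L\<^esub> q = (k \<otimes>\<^bsub>L\<^esub> inv\<^bsub>L\<^esub> k) [^]\<^bsub>L\<^esub> q"
      using k by (simp add: nat_pow_distrib Units_inv_closed del: Units_r_inv)
    then have "k \<otimes>\<^bsub>L\<^esub> inv\<^bsub>L\<^esub> k [^]\<^bsub>L\<^esub> q = \<one>\<^bsub>L\<^esub>"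
      using \<open>k \<in> Units L\<close> by simp
    then have "inv\<^bsub>L\<^esub> k = inv\<^bsub>L\<^esub> k [^]\<^bsub>L\<^esub> q"
      using k \<open>k \<in> Units L\<close> by (intro comm_inv_char) auto
    with \<open>k \<in> Units L\<close> show "inv\<^bsub>L\<^esub> k \<in> ?S" by auto
  qed
  then have S: "field (L\<lparr>carrier := ?S\<rparr>)"
    by (rule subfield_iff)
  obtain h :: "_ \<Rightarrow> nat" where h: "inj_on h ?S"
    using finite_imp_inj_to_nat_seg[OF fin] by blast
  have "field (image_ring h (L\<lparr>carrier := ?S\<rparr>))"
    using h by (intro field.inj_imp_image_ring_is_field[OF S]) simp
  moreover have "card (carrier (image_ring h (L\<lparr>carrier := ?S\<rparr>))) = q"
    using card_image[OF h] card by (simp add: image_ring_carrier)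
  ultimately show ?thesis by blast
qed

text \<open>
  A field with \<open>q\<close> elements cannot be a type when \<open>q\<close> is a variable.  All of them, one for each
  prime power \<open>q\<close> (and an arbitrary field for every other \<open>q\<close>), are therefore put into one type, their
  direct product.  The field with \<open>q\<close> elements is the factor at \<open>q\<close>, and calculations in it are
  calculations in a commutative ring in the sense of type classes.
\<close>

definition prime_power_field :: "nat \<Rightarrow> nat ring" where
  "prime_power_field q = (SOME R. field R \<and> (primepow q \<longrightarrow> card (carrier R) = q))"

lemma prime_power_field: "field (prime_power_field q)" "primepow q \<Longrightarrow> card (carrier (prime_power_field q)) = q"
proof -
  \<comment> \<open>If \<open>q\<close> is not a prime power, any field is a witness; the one of
    order 2 is at hand.\<close>
  have "primepow (2::nat)" by (simp add: primepow_prime)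
  then have "\<exists>R :: nat ring. field R \<and> (primepow q \<longrightarrow> card (carrier R) = q)"
    using ex_field_of_primepow_order by blast
  then have "field (prime_power_field q) \<and> (primepow q \<longrightarrow> card (carrier (prime_power_field q)) = q)"
    unfolding prime_power_field_def by (rule someI_ex)
  then show "field (prime_power_field q)" "primepow q \<Longrightarrow> card (carrier (prime_power_field q)) = q" by auto
qed

typedef field_product = "{f. \<forall>q. f q \<in> carrier (prime_power_field q)}"
  morphisms component Abs_field_product
proof
  have "\<zero>\<^bsub>prime_power_field q\<^esub> \<in> carrier (prime_power_field q)" for q
    using prime_power_field(1)[of q] by (simp add: field.is_ring ring.ring_simprules)
  then show "(\<lambda>q. \<zero>\<^bsub>prime_power_field q\<^esub>) \<in> {f. \<forall>q. f q \<in> carrier (prime_power_field q)}" by simp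
qed

setup_lifting type_definition_field_product

lemma component_in_carrier [simp]: "component x q \<in> carrier (prime_power_field q)"
  using component[of x] by simp

lemma field_product_eqI: "(\<And>q. component x q = component y q) \<Longrightarrow> x = y"
  by (metis component_inject ext)

instantiation field_product :: comm_ring_1
begin

lift_definition zero_field_product :: field_product is "\<lambda>q. \<zero>\<^bsub>prime_power_field q\<^esub>"
  using prime_power_field(1) by (simp add: field.is_ring ring.ring_simprules)
lift_definition one_field_product :: field_product is "\<lambda>q. \<one>\<^bsub>prime_power_field q\<^esub>"
  using prime_power_field(1) by (simp add: field.is_ring ring.ring_simprules)
lift_definition plus_field_product :: "field_product \<Rightarrow> field_product \<Rightarrow> field_product"
  is "\<lambda>f g q. f q \<oplus>\<^bsub>prime_power_field q\<^esub> g q"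
  using prime_power_field(1) by (simp add: field.is_ring ring.ring_simprules)
lift_definition times_field_product :: "field_product \<Rightarrow> field_product \<Rightarrow> field_product"
  is "\<lambda>f g q. f q \<otimes>\<^bsub>prime_power_field q\<^esub> g q"
  using prime_power_field(1) by (simp add: field.is_ring ring.ring_simprules)
lift_definition uminus_field_product :: "field_product \<Rightarrow> field_product"
  is "\<lambda>f q. \<ominus>\<^bsub>prime_power_field q\<^esub> f q"
  using prime_power_field(1) by (simp add: field.is_ring ring.ring_simprules)
definition minus_field_product :: "field_product \<Rightarrow> field_product \<Rightarrow> field_product"
  where "minus_field_product x y = x + - y"

lemmas component_simps = zero_field_product.rep_eq one_field_product.rep_eq plus_field_product.rep_eq
  times_field_product.rep_eq uminus_field_product.rep_eq

instance
proof
  fix a b c :: field_product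
  have cr: "cring (prime_power_field q)" for q
    using prime_power_field(1) by (simp add: field_def domain_def)
  note simps = component_simps cring.cring_simprules[OF cr]
  show "a * b * c = a * (b * c)" by (rule field_product_eqI) (simp add: simps)
  show "a * b = b * a" by (rule field_product_eqI) (simp add: component_simps cring.cring_simprules(14)[OF cr])
  show "1 * a = a" by (rule field_product_eqI) (simp add: component_simps cring.axioms(1)[OF cr] ring.ring_simprules)
  show "a + b + c = a + (b + c)" by (rule field_product_eqI) (simp add: simps)
  show "a + b = b + a" by (rule field_product_eqI) (simp add: component_simps cring.cring_simprules(10)[OF cr])
  show "0 + a = a" by (rule field_product_eqI) (simp add: simps)
  show "- a + a = 0" by (rule field_product_eqI) (simp add: simps)
  show "a - b = a + - b" by (simp add: minus_field_product_def)
  show "(a + b) * c = a * c + b * c" by (rule field_product_eqI) (simp add: simps)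
  have "component 0 2 \<noteq> component 1 2"
    using prime_power_field(1)[of 2] by (simp add: component_simps field_def domain_def domain_axioms_def)
  then show "(0::field_product) \<noteq> 1" by auto
qed

end

section \<open>Symplectic four-space over a finite field\<close>

datatype 'a vec = Vec 'a 'a 'a 'a

instantiation vec :: (ab_group_add) ab_group_add
begin

definition "0 = Vec 0 0 0 0"

definition "x + y = (case (x, y) of (Vec x1 x2 x3 x4, Vec y1 y2 y3 y4) \<Rightarrow>
  Vec (x1 + y1) (x2 + y2) (x3 + y3) (x4 + y4))"

definition "- x = (case x of Vec x1 x2 x3 x4 \<Rightarrow> Vec (- x1) (- x2) (- x3) (- x4))"

lemma plus_Vec [simp]: "Vec x1 x2 x3 x4 + Vec y1 y2 y3 y4 = Vec (x1 + y1) (x2 + y2) (x3 + y3) (x4 + y4)"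
  and uminus_Vec [simp]: "- Vec x1 x2 x3 x4 = Vec (- x1) (- x2) (- x3) (- x4)"
  by (simp_all add: plus_vec_def uminus_vec_def)

definition "x - y = x + - (y :: 'a vec)"

instance
proof
  fix x y z :: "'a vec"
  show "x + y + z = x + (y + z)" by (cases x; cases y; cases z) (simp add: add.assoc)
  show "x + y = y + x" by (cases x; cases y) (simp add: add.commute)
  show "0 + x = x" "- x + x = 0" by (cases x; simp add: zero_vec_def)+
  show "x - y = x + - y" by (rule minus_vec_def)
qed

end

fun smul :: "'a::comm_ring_1 \<Rightarrow> 'a vec \<Rightarrow> 'a vec" where
  "smul c (Vec x1 x2 x3 x4) = Vec (c * x1) (c * x2) (c * x3) (c * x4)"

text \<open>The standard alternating form, pairing coordinate 1 with 3 and coordinate 2 with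
  4.\<close>

fun sform :: "'a::comm_ring_1 vec \<Rightarrow> 'a vec \<Rightarrow> 'a" where
  "sform (Vec x1 x2 x3 x4) (Vec y1 y2 y3 y4) = x1 * y3 - x3 * y1 + x2 * y4 - x4 * y2"

lemma smul_add_right: "smul c (x + y) = smul c x + smul c y"
  by (cases x; cases y) (simp add: algebra_simps)

lemma smul_add_left: "smul (c + d) x = smul c x + smul d x"
  by (cases x) (simp add: algebra_simps)

lemma smul_smul: "smul c (smul d x) = smul (c * d) x"
  by (cases x) (simp add: algebra_simps)

lemma smul_uminus: "smul (- c) x = - smul c x"
  by (cases x) simp

lemma smul_0_left [simp]: "smul 0 x = 0"
  by (cases x) (simp add: zero_vec_def)

lemma smul_0_right [simp]: "smul c 0 = 0"
  by (simp add: zero_vec_def)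

lemmas smul_simps = smul_add_right smul_add_left smul_smul

lemma sform_add_left: "sform (x + y) z = sform x z + sform y z"
  by (cases x; cases y; cases z) (simp add: algebra_simps)

lemma sform_add_right: "sform z (x + y) = sform z x + sform z y"
  by (cases x; cases y; cases z) (simp add: algebra_simps)

lemma sform_smul_left: "sform (smul c x) y = c * sform x y"
  by (cases x; cases y) (simp add: algebra_simps)

lemma sform_smul_right: "sform x (smul c y) = c * sform x y"
  by (cases x; cases y) (simp add: algebra_simps)

lemma sform_self [simp]: "sform x x = 0"
  by (cases x) (simp add: algebra_simps)

lemma sform_commute: "sform x y = - sform y x"
  by (cases x; cases y) (simp add: algebra_simps)

lemma sform_0 [simp]: "sform 0 x = 0" "sform x 0 = 0"
  by (cases x, simp add: zero_vec_def)+

lemmas sform_simps = sform_add_left sform_add_right sform_smul_left sform_smul_right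

text \<open>The quotients behind three counts: nonzero vectors of the space, nonzero vectors of a
  line, and vectors orthogonal to a point but off it. Writing \<open>n\<close> as a successor
  removes the truncated subtractions.\<close>

lemma geometric_identities:
  fixes n :: nat
  assumes "n > 0"
  shows "n ^ 4 - 1 = (n - 1) * (n ^ 3 + n ^ 2 + n + 1)"
    and "n ^ 2 - 1 = (n - 1) * (n + 1)"
    and "n ^ 3 - n = (n ^ 2 - n) * (n + 1)"
proof -
  obtain k where n: "n = Suc k" using assms gr0_implies_Suc by blast
  show "n ^ 4 - 1 = (n - 1) * (n ^ 3 + n ^ 2 + n + 1)" "n ^ 2 - 1 = (n - 1) * (n + 1)"
    "n ^ 3 - n = (n ^ 2 - n) * (n + 1)"
    by (simp_all add: n algebra_simps eval_nat_numeral)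
qed

text \<open>The unit \<open>e\<close> is an idempotent of the ambient ring, in general different from \<open>1\<close>.\<close>

locale finite_subfield =
  fixes F :: "'a::comm_ring_1 set" and e :: 'a
  assumes finite_F [simp]: "finite F"
    and zero_F [simp]: "0 \<in> F" and unit_F [simp]: "e \<in> F" and unit_nz [simp]: "e \<noteq> 0"
    and add_F [simp]: "x \<in> F \<Longrightarrow> y \<in> F \<Longrightarrow> x + y \<in> F"
    and uminus_F [simp]: "x \<in> F \<Longrightarrow> - x \<in> F"
    and mult_F [simp]: "x \<in> F \<Longrightarrow> y \<in> F \<Longrightarrow> x * y \<in> F"
    and unit_mult [simp]: "x \<in> F \<Longrightarrow> e * x = x"
    and inverse_F: "x \<in> F \<Longrightarrow> x \<noteq> 0 \<Longrightarrow> \<exists>y\<in>F. x * y = e"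
begin

lemma diff_F [simp]: "x \<in> F \<Longrightarrow> y \<in> F \<Longrightarrow> x - y \<in> F"
  using add_F[of x "- y"] by simp

lemma mult_unit [simp]: "x \<in> F \<Longrightarrow> x * e = x"
  by (simp add: mult.commute)

text \<open>The ambient ring may have zero divisors, as a product of fields does; inside
  \<open>F\<close> inverses exclude them.\<close>

lemma mult_eq_0_F:
  assumes "x \<in> F" "y \<in> F"
  shows "x * y = 0 \<longleftrightarrow> x = 0 \<or> y = 0"
proof
  assume xy: "x * y = 0"
  show "x = 0 \<or> y = 0"
  proof (rule disjCI)
    assume "y \<noteq> 0"
    then obtain z where "y * z = e" using inverse_F assms by blast
    then have "x * e = (x * y) * z" by (simp add: mult.assoc)
    then show "x = 0" using xy assms by simp
  qed
qed auto

section \<open>The space \<open>V\<close>, symplectic bases and isometries\<close>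

definition V :: "'a vec set" where
  "V = (\<lambda>(a, b, c, d). Vec a b c d) ` (F \<times> F \<times> F \<times> F)"

lemma Vec_in_V [simp]: "Vec a b c d \<in> V \<longleftrightarrow> a \<in> F \<and> b \<in> F \<and> c \<in> F \<and> d \<in> F"
  by (force simp: V_def)

abbreviation q :: nat where "q \<equiv> card F"

lemma finite_V [simp]: "finite V"
  by (simp add: V_def)

lemma card_V: "card V = q ^ 4"
proof -
  have "inj (\<lambda>(a, b, c, d). Vec a b c d)" by (auto intro: injI)
  then have "card V = card (F \<times> F \<times> F \<times> F)"
    unfolding V_def by (intro card_image) (auto intro: inj_on_subset)
  then show ?thesis by (simp add: eval_nat_numeral)
qed

lemma zero_V [simp]: "0 \<in> V"
  by (simp add: zero_vec_def)

lemma add_V [simp]: "x \<in> V \<Longrightarrow> y \<in> V \<Longrightarrow> x + y \<in> V"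
  by (cases x; cases y) simp

lemma smul_V [simp]: "c \<in> F \<Longrightarrow> x \<in> V \<Longrightarrow> smul c x \<in> V"
  by (cases x) simp

lemma sform_F [simp]: "x \<in> V \<Longrightarrow> y \<in> V \<Longrightarrow> sform x y \<in> F"
  by (cases x; cases y) simp

lemma smul_unit [simp]: "x \<in> V \<Longrightarrow> smul e x = x"
  by (cases x) simp

lemma smul_eq_0: "c \<in> F \<Longrightarrow> x \<in> V \<Longrightarrow> smul c x = 0 \<longleftrightarrow> c = 0 \<or> x = 0"
  by (cases x) (auto simp: zero_vec_def mult_eq_0_F)

text \<open>The form pairs a nonzero coordinate of \<open>v\<close> with a single coordinate of
  \<open>w\<close>. The inverse is placed there, negated when it answers coordinate 3 or 4, where
  the form carries a minus sign.\<close>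

lemma sform_nondegenerate:
  assumes "v \<in> V" and "v \<noteq> 0"
  shows "\<exists>w\<in>V. sform v w = e"
proof -
  obtain v1 v2 v3 v4 where v: "v = Vec v1 v2 v3 v4" by (cases v)
  then consider "v1 \<noteq> 0" | "v2 \<noteq> 0" | "v3 \<noteq> 0" | "v4 \<noteq> 0"
    using assms by (auto simp: zero_vec_def)
  then show ?thesis
  proof cases
    case 1
    then obtain y where "y \<in> F" "v1 * y = e" using inverse_F assms v by auto
    then show ?thesis using v by (intro bexI[of _ "Vec 0 0 y 0"]) auto
  next
    case 2
    then obtain y where "y \<in> F" "v2 * y = e" using inverse_F assms v by auto
    then show ?thesis using v by (intro bexI[of _ "Vec 0 0 0 y"]) auto
  next
    case 3
    then obtain y where "y \<in> F" "v3 * y = e" using inverse_F assms v by auto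
    then show ?thesis using v by (intro bexI[of _ "Vec (- y) 0 0 0"]) auto
  next
    case 4
    then obtain y where "y \<in> F" "v4 * y = e" using inverse_F assms v by auto
    then show ?thesis using v by (intro bexI[of _ "Vec 0 (- y) 0 0"]) auto
  qed
qed

text \<open>The hyperbolic pairs are \<open>(a, c)\<close> and \<open>(b, d)\<close>, as for the
  unit vectors. Thus \<open>a\<close> and \<open>b\<close> span a totally isotropic line and
  \<open>c\<close> spans a point off it. Linear independence follows from
  \<open>lin_comb_coords\<close>.\<close>

definition symplectic_basis :: "'a vec \<Rightarrow> 'a vec \<Rightarrow> 'a vec \<Rightarrow> 'a vec \<Rightarrow> bool" where
  "symplectic_basis a b c d \<longleftrightarrow> {a, b, c, d} \<subseteq> V \<and> sform a c = e \<and> sform b d = e \<and>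
     sform a b = 0 \<and> sform a d = 0 \<and> sform c b = 0 \<and> sform c d = 0"

fun lin_comb :: "'a vec \<Rightarrow> 'a vec \<Rightarrow> 'a vec \<Rightarrow> 'a vec \<Rightarrow> 'a vec \<Rightarrow> 'a vec" where
  "lin_comb a b c d (Vec x1 x2 x3 x4) = smul x1 a + smul x2 b + smul x3 c + smul x4 d"

lemma symplectic_basis_values:
  assumes "symplectic_basis a b c d"
  shows "a \<in> V" "b \<in> V" "c \<in> V" "d \<in> V"
    "sform a b = 0" "sform a c = e" "sform a d = 0" "sform b a = 0" "sform b c = 0" "sform b d = e"
    "sform c a = - e" "sform c b = 0" "sform c d = 0" "sform d a = 0" "sform d b = - e" "sform d c = 0"
  using assms sform_commute[of b a] sform_commute[of c a] sform_commute[of d a] sform_commute[of b c]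
    sform_commute[of d b] sform_commute[of d c]
  by (auto simp: symplectic_basis_def)

lemma lin_comb_V [simp]: "symplectic_basis a b c d \<Longrightarrow> x \<in> V \<Longrightarrow> lin_comb a b c d x \<in> V"
  using symplectic_basis_values(1-4) by (cases x) (auto intro!: add_V smul_V)

lemma sform_lin_comb:
  assumes "symplectic_basis a b c d" and "x \<in> V" and "y \<in> V"
  shows "sform (lin_comb a b c d x) (lin_comb a b c d y) = sform x y"
  using assms(2,3)
  by (cases x; cases y) (auto simp: sform_simps symplectic_basis_values[OF assms(1)] algebra_simps)

lemma lin_comb_coords:
  assumes "symplectic_basis a b c d" and "Vec x1 x2 x3 x4 \<in> V" and "v = lin_comb a b c d (Vec x1 x2 x3 x4)"
  shows "sform v c = x1" "sform v d = x2" "sform a v = x3" "sform b v = x4"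
  using assms(2,3) by (auto simp: sform_simps symplectic_basis_values[OF assms(1)])

text \<open>Injective because pairing with the basis recovers the coordinates, and hence surjective
  because \<open>V\<close> is finite.\<close>

lemma lin_comb_bij:
  assumes "symplectic_basis a b c d"
  shows "bij_betw (lin_comb a b c d) V V"
proof -
  have "inj_on (lin_comb a b c d) V"
  proof (rule inj_onI)
    fix x y assume "x \<in> V" "y \<in> V" "lin_comb a b c d x = lin_comb a b c d y"
    then show "x = y"
      using lin_comb_coords[OF assms] by (cases x; cases y) metis
  qed
  moreover have "lin_comb a b c d ` V \<subseteq> V"
    using lin_comb_V[OF assms] by blast
  ultimately show ?thesis
    by (simp add: bij_betw_def endo_inj_surj)
qed

definition isometry :: "('a vec \<Rightarrow> 'a vec) \<Rightarrow> bool" where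
  "isometry g \<longleftrightarrow> bij_betw g V V \<and> (\<forall>x\<in>V. \<forall>y\<in>V. g (x + y) = g x + g y) \<and>
     (\<forall>c\<in>F. \<forall>x\<in>V. g (smul c x) = smul c (g x)) \<and> (\<forall>x\<in>V. \<forall>y\<in>V. sform (g x) (g y) = sform x y)"

lemma isometry_lin_comb:
  assumes "symplectic_basis a b c d"
  shows "isometry (lin_comb a b c d)"
proof -
  have "lin_comb a b c d (x + y) = lin_comb a b c d x + lin_comb a b c d y" for x y
    by (cases x; cases y) (simp add: smul_add_left)
  moreover have "lin_comb a b c d (smul s x) = smul s (lin_comb a b c d x)" for s x
    by (cases x) (simp add: smul_simps)
  ultimately show ?thesis
    using lin_comb_bij[OF assms] sform_lin_comb[OF assms] by (simp add: isometry_def)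
qed

text \<open>One step of symplectic Gram-Schmidt. It yields bases adapted to a line, to an antiflag
  and, in \<open>point_regularity\<close>, to a hyperbolic pair.\<close>

lemma complete_symplectic_basis:
  assumes V: "a \<in> V" "b \<in> V" "c \<in> V" and "sform a c = e" "sform a b = 0" "sform c b = 0" "b \<noteq> 0"
  shows "\<exists>d. symplectic_basis a b c d"
proof -
  obtain w where w: "w \<in> V" "sform b w = e"
    using sform_nondegenerate assms by blast
  \<comment> \<open>The corrections along \<open>a\<close> and \<open>c\<close> make
    \<open>w\<close> orthogonal to both; they are orthogonal to \<open>b\<close>, so the value
    \<open>e\<close> against \<open>b\<close> survives.\<close>
  let ?d = "w + smul (sform c w) a + smul (- sform a w) c"
  have "sform b a = 0" "sform b c = 0" "sform c a = - e"
    using assms sform_commute[of b a] sform_commute[of b c] sform_commute[of c a] by auto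
  then have "symplectic_basis a b c ?d"
    using assms w by (auto simp: symplectic_basis_def sform_simps)
  then show ?thesis ..
qed

section \<open>Points and totally isotropic lines\<close>

definition span1 :: "'a vec \<Rightarrow> 'a vec set" where
  "span1 v = (\<lambda>s. smul s v) ` F"

definition span2 :: "'a vec \<Rightarrow> 'a vec \<Rightarrow> 'a vec set" where
  "span2 v w = (\<lambda>(s, t). smul s v + smul t w) ` (F \<times> F)"

text \<open>Points and lines are sets of vectors containing \<open>0\<close>, so that incidence is inclusion.\<close>

definition Points :: "'a vec set set" where
  "Points = {span1 v | v. v \<in> V \<and> v \<noteq> 0}"

definition Lines :: "'a vec set set" where
  "Lines = {span2 v w | v w. v \<in> V \<and> w \<in> V \<and> v \<noteq> 0 \<and> w \<notin> span1 v \<and> sform v w = 0}"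

lemma mem_span1 [simp]: "v \<in> V \<Longrightarrow> v \<in> span1 v"
  unfolding span1_def by (rule rev_image_eqI[of e]) auto

lemma isometry_image_span1: "isometry g \<Longrightarrow> v \<in> V \<Longrightarrow> g ` span1 v = span1 (g v)"
  by (auto simp: isometry_def span1_def image_image)

lemma isometry_image_span2: "isometry g \<Longrightarrow> v \<in> V \<Longrightarrow> w \<in> V \<Longrightarrow> g ` span2 v w = span2 (g v) (g w)"
  unfolding span2_def image_image by (rule image_cong) (auto simp: isometry_def)

lemma isometry_V: "isometry g \<Longrightarrow> v \<in> V \<Longrightarrow> g v \<in> V"
  by (auto simp: isometry_def bij_betw_def)

lemma isometry_0: "isometry g \<Longrightarrow> g 0 = 0"
  unfolding isometry_def using zero_F zero_V smul_0_left by fastforce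

lemma isometry_eq: "isometry g \<Longrightarrow> v \<in> V \<Longrightarrow> w \<in> V \<Longrightarrow> g v = g w \<longleftrightarrow> v = w"
  by (auto simp: isometry_def bij_betw_def inj_on_def)

lemma span1_subset_V: "v \<in> V \<Longrightarrow> span1 v \<subseteq> V"
  by (auto simp: span1_def)

lemma span2_subset_V: "v \<in> V \<Longrightarrow> w \<in> V \<Longrightarrow> span2 v w \<subseteq> V"
  by (auto simp: span2_def)

lemma span2_generators: "v \<in> V \<Longrightarrow> w \<in> V \<Longrightarrow> v \<in> span2 v w \<and> w \<in> span2 v w"
  unfolding span2_def by (intro conjI; rule rev_image_eqI[of "(e, 0)"] rev_image_eqI[of "(0, e)"]) auto

lemma Points_subset_V: "P \<in> Points \<Longrightarrow> P \<subseteq> V"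
  using span1_subset_V by (auto simp: Points_def)

lemma Lines_subset_V: "L \<in> Lines \<Longrightarrow> L \<subseteq> V"
  using span2_subset_V by (fastforce simp: Lines_def)

lemma isometry_Points:
  assumes "isometry g" "P \<in> Points"
  shows "g ` P \<in> Points"
proof -
  obtain v where v: "P = span1 v" "v \<in> V" "v \<noteq> 0"
    using assms by (auto simp: Points_def)
  then have "g v \<noteq> 0"
    using isometry_eq[OF assms(1) v(2) zero_V] isometry_0[OF assms(1)] by simp
  then show ?thesis
    using isometry_image_span1[OF assms(1) v(2)] isometry_V[OF assms(1) v(2)] v unfolding Points_def by blast
qed

lemma isometry_Lines:
  assumes "isometry g" "L \<in> Lines"
  shows "g ` L \<in> Lines"
proof -
  obtain v w where vw: "L = span2 v w" "v \<in> V" "w \<in> V" "v \<noteq> 0" "w \<notin> span1 v" "sform v w = 0"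
    using assms by (auto simp: Lines_def)
  have "g w \<notin> g ` span1 v"
    using vw span1_subset_V[OF vw(2)] isometry_eq[OF assms(1)] by blast
  then have "g w \<notin> span1 (g v)"
    using isometry_image_span1[OF assms(1) vw(2)] by simp
  moreover have "g v \<noteq> 0"
    using isometry_eq[OF assms(1) vw(2) zero_V] isometry_0[OF assms(1)] vw by simp
  moreover have "sform (g v) (g w) = 0"
    using assms vw by (simp add: isometry_def)
  ultimately show ?thesis
    using isometry_image_span2[OF assms(1) vw(2,3)] isometry_V[OF assms(1)] vw unfolding Lines_def by blast
qed

lemma span2_shear:
  assumes "s \<in> F" "v \<in> V" "w \<in> V"
  shows "span2 v (w + smul s v) = span2 v w"
proof -
  have "span2 v (w + smul s v) \<subseteq> span2 v w" if "s \<in> F" "w \<in> V" for s w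
  proof
    fix x assume "x \<in> span2 v (w + smul s v)"
    then obtain a b where ab: "a \<in> F" "b \<in> F" "x = smul a v + smul b (w + smul s v)"
      by (auto simp: span2_def)
    then have "x = smul (a + b * s) v + smul b w"
      by (simp add: smul_simps algebra_simps)
    then show "x \<in> span2 v w"
      using ab that by (auto simp: span2_def)
  qed
  \<comment> \<open>The second instance shears back by \<open>- s\<close> and supplies the reverse
    inclusion.\<close>
  from this[of s w] this[of "- s" "w + smul s v"] show ?thesis
    using assms by (simp add: smul_uminus)
qed

lemma Lines_symplectic_basis:
  assumes "L \<in> Lines"
  shows "\<exists>a b c d. symplectic_basis a b c d \<and> L = span2 a b"
proof -
  obtain v w where vw: "L = span2 v w" "v \<in> V" "w \<in> V" "v \<noteq> 0" "w \<notin> span1 v" "sform v w = 0"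
    using assms by (auto simp: Lines_def)
  obtain c where c: "c \<in> V" "sform v c = e"
    using sform_nondegenerate vw by blast
  \<comment> \<open>The multiple of \<open>v\<close> is chosen to make \<open>?b\<close> orthogonal
    to \<open>c\<close>, since \<open>sform c v = - e\<close>; the shear does not change the
    span.\<close>
  let ?b = "w + smul (sform c w) v"
  have "sform c ?b = 0" "sform v ?b = 0"
    using c vw by (auto simp: sform_simps sform_commute[of c v])
  moreover have "?b \<noteq> 0"
  proof
    assume "?b = 0"
    then have "w = smul (- sform c w) v"
      by (simp add: smul_uminus eq_neg_iff_add_eq_0)
    then show False
      using vw c unfolding span1_def by (metis imageI sform_F uminus_F)
  qed
  ultimately obtain d where "symplectic_basis v ?b c d"
    using complete_symplectic_basis[of v ?b c] vw c by auto
  moreover have "L = span2 v ?b"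
    using span2_shear[of "sform c w" v w] vw c by simp
  ultimately show ?thesis by blast
qed

lemma card_span2:
  assumes "symplectic_basis a b c d"
  shows "card (span2 a b) = q ^ 2"
proof -
  have "inj_on (\<lambda>(s, t). smul s a + smul t b) (F \<times> F)"
  proof (rule inj_onI)
    fix x y assume xy: "x \<in> F \<times> F" "y \<in> F \<times> F"
      "(case x of (s, t) \<Rightarrow> smul s a + smul t b) = (case y of (s, t) \<Rightarrow> smul s a + smul t b)"
    obtain s t s' t' where [simp]: "x = (s, t)" "y = (s', t')" by (cases x; cases y) blast
    have "sform (smul s a + smul t b) c = s" "sform (smul s a + smul t b) d = t"
      "sform (smul s' a + smul t' b) c = s'" "sform (smul s' a + smul t' b) d = t'"
      using xy(1,2) by (simp_all add: sform_simps symplectic_basis_values[OF assms])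
    then show "x = y" using xy(3) by simp
  qed
  then show ?thesis
    by (simp add: span2_def card_image card_cartesian_product power2_eq_square)
qed

lemma card_Lines: "L \<in> Lines \<Longrightarrow> card L = q ^ 2"
  using Lines_symplectic_basis card_span2 by blast

lemma card_Points: "P \<in> Points \<Longrightarrow> card P = q"
proof -
  assume "P \<in> Points"
  then obtain v where v: "P = span1 v" "v \<in> V" "v \<noteq> 0" by (auto simp: Points_def)
  have "inj_on (\<lambda>s. smul s v) F"
  proof (rule inj_onI)
    fix s t assume *: "s \<in> F" "t \<in> F" "smul s v = smul t v"
    then have "smul (s - t) v = 0"
      using smul_add_left[of s "- t" v] by (simp add: smul_uminus)
    then show "s = t"
      using * v smul_eq_0[of "s - t" v] by simp
  qed
  then show ?thesis using v by (simp add: span1_def card_image)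
qed

lemma Lines_add: "L \<in> Lines \<Longrightarrow> x \<in> L \<Longrightarrow> y \<in> L \<Longrightarrow> x + y \<in> L"
  and Lines_smul: "L \<in> Lines \<Longrightarrow> x \<in> L \<Longrightarrow> s \<in> F \<Longrightarrow> smul s x \<in> L"
  and Lines_isotropic: "L \<in> Lines \<Longrightarrow> x \<in> L \<Longrightarrow> y \<in> L \<Longrightarrow> sform x y = 0"
proof -
  assume "L \<in> Lines"
  then obtain v w where vw: "L = span2 v w" "v \<in> V" "w \<in> V" "sform v w = 0"
    by (auto simp: Lines_def)
  have "(smul s v + smul t w) + (smul s' v + smul t' w) = smul (s + s') v + smul (t + t') w" for s t s' t'
    by (simp add: smul_add_left)
  moreover assume "x \<in> L" "y \<in> L"
  ultimately show "x + y \<in> L"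
    unfolding vw(1) span2_def by (auto intro!: image_eqI[of _ _ "(_, _)"])
next
  assume "L \<in> Lines"
  then obtain v w where vw: "L = span2 v w" "v \<in> V" "w \<in> V" "sform v w = 0"
    by (auto simp: Lines_def)
  assume "x \<in> L" "s \<in> F"
  then show "smul s x \<in> L"
    unfolding vw(1) span2_def by (auto simp: smul_simps intro!: image_eqI[of _ _ "(_, _)"])
next
  assume "L \<in> Lines"
  then obtain v w where vw: "L = span2 v w" "v \<in> V" "w \<in> V" "sform v w = 0"
    by (auto simp: Lines_def)
  have "sform w v = 0" using vw sform_commute[of w v] by simp
  moreover assume "x \<in> L" "y \<in> L"
  ultimately show "sform x y = 0"
    using vw by (auto simp: span2_def sform_simps)
qed

lemma span1_subset_iff: "L \<in> Lines \<Longrightarrow> v \<in> V \<Longrightarrow> span1 v \<subseteq> L \<longleftrightarrow> v \<in> L"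
  using Lines_smul[of L v] mem_span1[of v] unfolding span1_def by blast

lemma span2_subset: "L \<in> Lines \<Longrightarrow> v \<in> L \<Longrightarrow> w \<in> L \<Longrightarrow> span2 v w \<subseteq> L"
  by (auto simp: span2_def Lines_add Lines_smul)

text \<open>The heart of edge-transitivity. A totally isotropic line is its own orthogonal
  complement, so a generator \<open>p\<close> of a point off \<open>L\<close> pairs nontrivially
  with \<open>L\<close>. Hence \<open>L\<close> has a basis of one vector with value
  \<open>e\<close> against \<open>p\<close> and one orthogonal to \<open>p\<close>, and completing
  it gives the adapted basis with \<open>c = p\<close>.\<close>

lemma antiflag_symplectic_basis:
  assumes P: "P \<in> Points" and L: "L \<in> Lines" and PL: "\<not> P \<subseteq> L"
  shows "\<exists>a b c d. symplectic_basis a b c d \<and> P = span1 c \<and> L = span2 a b"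
proof -
  obtain p where p: "P = span1 p" "p \<in> V" "p \<noteq> 0" using P by (auto simp: Points_def)
  obtain u v w z where B: "symplectic_basis u v w z" and Luv: "L = span2 u v"
    using Lines_symplectic_basis[OF L] by blast
  note vals = symplectic_basis_values[OF B]
  have uL: "u \<in> L" and vL: "v \<in> L"
    unfolding Luv using span2_generators vals(1,2) by auto
  define r s where "r = sform u p" and "s = sform v p"
  have rs: "r \<in> F" "s \<in> F" using vals p by (auto simp: r_def s_def)
  have "r \<noteq> 0 \<or> s \<noteq> 0"
  proof (rule ccontr)
    assume *: "\<not> (r \<noteq> 0 \<or> s \<noteq> 0)"
    \<comment> \<open>Otherwise the third and fourth coordinates of \<open>p\<close>, which are its
      pairings with \<open>u\<close> and \<open>v\<close>, vanish and \<open>p\<close> lies on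
      \<open>L\<close>.\<close>
    have "p \<in> lin_comb u v w z ` V" using lin_comb_bij[OF B] p by (simp add: bij_betw_def)
    then obtain x1 x2 x3 x4 where x: "Vec x1 x2 x3 x4 \<in> V" "p = lin_comb u v w z (Vec x1 x2 x3 x4)"
      by (metis imageE vec.exhaust)
    from lin_comb_coords[OF B x] have "x3 = 0" "x4 = 0" using * by (auto simp: r_def s_def)
    with x have "p \<in> span2 u v" by (auto simp: span2_def)
    then show False using PL p span1_subset_iff[OF L] Luv by simp
  qed
  then obtain m n where mn: "m \<in> F" "n \<in> F" "m * r + n * s = e"
  proof (cases "r = 0")
    case True
    then obtain y where "y \<in> F" "s * y = e" using inverse_F[of s] rs \<open>r \<noteq> 0 \<or> s \<noteq> 0\<close> by blast
    then show thesis using that[of 0 y] by (simp add: mult.commute)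
  next
    case False
    then obtain y where "y \<in> F" "r * y = e" using inverse_F[of r] rs by blast
    then show thesis using that[of y 0] by (simp add: mult.commute)
  qed
  \<comment> \<open>By the choice of \<open>m\<close> and \<open>n\<close>, \<open>?a\<close> has
    value \<open>m * r + n * s = e\<close> against \<open>p\<close>; \<open>?b\<close> generates the
    kernel of pairing with \<open>p\<close> on \<open>L\<close>.\<close>
  let ?a = "smul m u + smul n v" and ?b = "smul s u + smul (- r) v"
  have ab: "?a \<in> L" "?b \<in> L" using uL vL mn rs L by (auto simp: Lines_add Lines_smul)
  have "sform ?a p = e" using mn by (simp add: sform_simps r_def s_def)
  moreover have "sform ?b p = 0" by (simp add: sform_simps r_def s_def mult.commute)
  then have "sform p ?b = 0" using sform_commute[of p ?b] by simp
  moreover have "sform ?a ?b = 0" using Lines_isotropic[OF L ab] .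
  moreover have "?b \<noteq> 0"
  proof
    assume b0: "?b = 0"
    have "sform ?b w = s" "sform ?b z = - r" using vals rs by (simp_all add: sform_simps)
    with b0 \<open>r \<noteq> 0 \<or> s \<noteq> 0\<close> show False by simp
  qed
  ultimately obtain d where d: "symplectic_basis ?a ?b p d"
    using complete_symplectic_basis[of ?a ?b p] p ab Lines_subset_V[OF L] by blast
  have "span2 ?a ?b \<subseteq> L" using span2_subset[OF L ab] .
  moreover have "card (span2 ?a ?b) = card L" using card_span2[OF d] card_Lines[OF L] by simp
  ultimately have "span2 ?a ?b = L"
    using finite_subset[OF Lines_subset_V[OF L] finite_V] by (intro card_subset_eq)
  then show ?thesis
    using d p(1) by (intro exI[of _ ?a] exI[of _ ?b] exI[of _ p] exI[of _ d]) simp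
qed

section \<open>Counting points, lines and incidences\<close>

lemma q_gt_1: "q > 1"
proof -
  have "card {0, e} = 2" using unit_nz by (simp add: card_2_iff)
  moreover have "card {0, e} \<le> q" by (rule card_mono) auto
  ultimately show ?thesis by simp
qed

lemma finite_Points [simp]: "finite Points"
  using Points_subset_V by (intro finite_subset[of Points "Pow V"]) auto

lemma finite_Lines [simp]: "finite Lines"
  using Lines_subset_V by (intro finite_subset[of Lines "Pow V"]) auto

lemma span1_Points: "v \<in> V \<Longrightarrow> v \<noteq> 0 \<Longrightarrow> span1 v \<in> Points"
  by (auto simp: Points_def)

lemma zero_mem_span1 [simp]: "0 \<in> span1 v"
  unfolding span1_def by (rule rev_image_eqI[of 0]) auto

text \<open>Holds by cardinality. Consequently distinct points meet only in \<open>0\<close>, which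
  makes them classes of a partition once \<open>0\<close> is removed.\<close>

lemma Points_eq_span1:
  assumes "P \<in> Points" "v \<in> P" "v \<noteq> 0"
  shows "P = span1 v"
proof -
  have v: "v \<in> V" using assms Points_subset_V by blast
  have "span1 v \<subseteq> P"
    using assms(1,2) by (auto simp: Points_def span1_def smul_smul)
  then have "span1 v = P"
    using finite_subset[OF Points_subset_V[OF assms(1)] finite_V] card_Points[OF assms(1)]
      card_Points[OF span1_Points[OF v assms(3)]] by (intro card_subset_eq) auto
  then show ?thesis by simp
qed

text \<open>The nonzero vectors of \<open>S\<close> fall into disjoint classes of size
  \<open>q - 1\<close>, one for each point. Applied to the whole space and to a line.\<close>

lemma card_Points_within:
  assumes "S \<subseteq> V" "0 \<in> S" "\<And>v. v \<in> S \<Longrightarrow> span1 v \<subseteq> S"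
  shows "(q - 1) * card {P \<in> Points. P \<subseteq> S} = card S - 1"
proof -
  let ?X = "{P \<in> Points. P \<subseteq> S}"
  let ?C = "(\<lambda>P. P - {0}) ` ?X"
  have zero: "0 \<in> P" if "P \<in> Points" for P
    using that by (auto simp: Points_def)
  have "inj_on (\<lambda>P. P - {0}) ?X"
  proof (rule inj_onI)
    fix P Q assume "P \<in> ?X" "Q \<in> ?X" "P - {0} = Q - {0}"
    then show "P = Q" using zero[of P] zero[of Q] by blast
  qed
  then have cardC: "card ?C = card ?X" by (rule card_image)
  have "\<Union>?C = S - {0}"
  proof
    show "S - {0} \<subseteq> \<Union>?C"
    proof
      fix v assume "v \<in> S - {0}"
      then show "v \<in> \<Union>?C"
        using assms span1_Points[of v] mem_span1[of v] by (intro UnionI[of "span1 v - {0}"]) auto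
    qed
  qed auto
  moreover have "(q - 1) * card ?C = card (\<Union>?C)"
  proof (rule card_partition)
    show "finite ?C" by simp
    show "finite (\<Union>?C)" unfolding \<open>\<Union>?C = S - {0}\<close> using finite_subset[OF assms(1)] by simp
    show "card c = q - 1" if "c \<in> ?C" for c
      using that card_Points zero finite_subset[OF Points_subset_V finite_V] by auto
    show "c \<inter> d = {}" if "c \<in> ?C" "d \<in> ?C" "c \<noteq> d" for c d
      using that Points_eq_span1 by blast
  qed
  moreover have "card (S - {0}) = card S - 1"
    using assms(2) by simp
  ultimately show ?thesis using cardC by simp
qed

lemma card_all_Points: "card Points = q ^ 3 + q ^ 2 + q + 1"
proof -
  have "{P \<in> Points. P \<subseteq> V} = Points" using Points_subset_V by blast
  with card_Points_within[OF subset_refl zero_V span1_subset_V] have "(q - 1) * card Points = q ^ 4 - 1"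
    by (simp only: card_V)
  also have "\<dots> = (q - 1) * (q ^ 3 + q ^ 2 + q + 1)"
    using q_gt_1 by (intro geometric_identities) simp
  finally show ?thesis using q_gt_1 by (simp only: nat_mult_eq_cancel1 zero_less_diff)
qed

lemma card_Points_on_line:
  assumes L: "L \<in> Lines"
  shows "card {P \<in> Points. P \<subseteq> L} = q + 1"
proof -
  have "L \<noteq> {}" using card_Lines[OF L] q_gt_1 by auto
  then have "0 \<in> L" using Lines_smul[OF L _ zero_F] by auto
  moreover have "span1 v \<subseteq> L" if "v \<in> L" for v
    using that span1_subset_iff[OF L] Lines_subset_V[OF L] by blast
  ultimately have "(q - 1) * card {P \<in> Points. P \<subseteq> L} = q ^ 2 - 1"
    using card_Points_within[OF Lines_subset_V[OF L]] by (simp only: card_Lines[OF L])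
  also have "\<dots> = (q - 1) * (q + 1)"
    using q_gt_1 by (intro geometric_identities) simp
  finally show ?thesis using q_gt_1 by (simp only: nat_mult_eq_cancel1 zero_less_diff)
qed

text \<open>By cardinality; in particular two distinct points lie on at most one common
  line.\<close>

lemma Lines_eq_span2:
  assumes L: "L \<in> Lines" and "v \<in> L" "v \<noteq> 0" "w \<in> L" "w \<notin> span1 v"
  shows "L = span2 v w"
proof -
  have vw: "v \<in> V" "w \<in> V" using assms Lines_subset_V by auto
  then have "span2 v w \<in> Lines"
    unfolding Lines_def using assms Lines_isotropic[OF L] by blast
  moreover have "span2 v w \<subseteq> L" using span2_subset assms by simp
  ultimately have "span2 v w = L"
    using finite_subset[OF Lines_subset_V[OF L] finite_V] by (intro card_subset_eq) (auto simp: card_Lines L)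
  then show ?thesis by simp
qed

text \<open>A vector \<open>w\<close> with value \<open>e\<close> against \<open>p\<close> gives a
  unique decomposition of every vector into one orthogonal to \<open>p\<close> and a multiple of
  \<open>w\<close>, so \<open>q^4\<close> is \<open>q\<close> times the cardinality sought.\<close>

lemma card_perp:
  assumes "p \<in> V" "p \<noteq> 0"
  shows "card {x \<in> V. sform p x = 0} = q ^ 3"
proof -
  let ?T = "{x \<in> V. sform p x = 0}"
  obtain w where w: "w \<in> V" "sform p w = e" using sform_nondegenerate assms by blast
  have "bij_betw (\<lambda>(t, s). t + smul s w) (?T \<times> F) V"
  proof (rule bij_betw_byWitness[where f' = "\<lambda>x. (x - smul (sform p x) w, sform p x)"])
    show "\<forall>x\<in>?T \<times> F. (\<lambda>x. (x - smul (sform p x) w, sform p x)) (case x of (t, s) \<Rightarrow> t + smul s w) = x"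
      using w by (auto simp: sform_simps)
    have "sform p (x - smul (sform p x) w) = 0" "x - smul (sform p x) w \<in> V" if "x \<in> V" for x
    proof -
      have *: "x - smul (sform p x) w = x + smul (- sform p x) w" by (simp add: smul_uminus)
      show "sform p (x - smul (sform p x) w) = 0" "x - smul (sform p x) w \<in> V"
        unfolding * using w that assms(1) by (simp_all add: sform_simps)
    qed
    then show "(\<lambda>x. (x - smul (sform p x) w, sform p x)) ` V \<subseteq> ?T \<times> F"
      using assms(1) by auto
  qed (use w in auto)
  then have "card ?T * q = q ^ 4"
    using bij_betw_same_card card_V by (fastforce simp: card_cartesian_product)
  then have "q * card ?T = q * q ^ 3" by (simp add: eval_nat_numeral algebra_simps)
  moreover have "q > 0" using q_gt_1 by linarith
  ultimately show ?thesis by (simp only: nat_mult_eq_cancel1)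
qed

text \<open>With \<open>P\<close> removed, the lines through \<open>P\<close> partition the vectors
  orthogonal to \<open>p\<close> outside \<open>P\<close> into classes of size
  \<open>q^2 - q\<close>; there are \<open>q^3 - q\<close> such vectors.\<close>

lemma card_Lines_through:
  assumes P: "P \<in> Points"
  shows "card {L \<in> Lines. P \<subseteq> L} = q + 1"
proof -
  obtain p where p: "P = span1 p" "p \<in> V" "p \<noteq> 0" using P by (auto simp: Points_def)
  let ?X = "{L \<in> Lines. P \<subseteq> L}" and ?T = "{x \<in> V. sform p x = 0}"
  let ?C = "(\<lambda>L. L - P) ` ?X"
  have "inj_on (\<lambda>L. L - P) ?X" by (rule inj_onI) blast
  then have cardC: "card ?C = card ?X" by (rule card_image)
  have finP: "finite P" using finite_subset[OF Points_subset_V[OF P] finite_V] .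
  have eq: "L = span2 p x" if "L \<in> ?X" "x \<in> L - P" for L x
    using Lines_eq_span2[of L p x] span1_subset_iff[of L p] that p by auto
  have PT: "P \<subseteq> ?T" using p by (auto simp: span1_def sform_simps)
  have U: "\<Union>?C = ?T - P"
  proof
    show "\<Union>?C \<subseteq> ?T - P"
      using Lines_subset_V Lines_isotropic span1_subset_iff p by blast
    show "?T - P \<subseteq> \<Union>?C"
    proof
      fix x assume x: "x \<in> ?T - P"
      then have "span2 p x \<in> Lines"
        unfolding Lines_def using p by auto
      then show "x \<in> \<Union>?C"
        using x p span2_generators[of p x] span1_subset_iff by (intro UnionI[of "span2 p x - P"]) auto
    qed
  qed
  have "(q ^ 2 - q) * card ?C = card (\<Union>?C)"
  proof (rule card_partition)
    show "finite ?C" by simp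
    show "finite (\<Union>?C)" unfolding U by simp
    show "card c = q ^ 2 - q" if "c \<in> ?C" for c
      using that card_Points[OF P] card_Lines finP by (auto simp: card_Diff_subset)
    show "c \<inter> d = {}" if "c \<in> ?C" "d \<in> ?C" "c \<noteq> d" for c d
      using that eq by blast
  qed
  also have "\<dots> = q ^ 3 - q"
    unfolding U using PT finP card_Points[OF P] card_perp[OF p(2,3)] by (simp add: card_Diff_subset)
  also have "\<dots> = (q ^ 2 - q) * (q + 1)"
    using q_gt_1 by (intro geometric_identities) simp
  finally have "(q ^ 2 - q) * card ?C = (q ^ 2 - q) * (q + 1)" .
  moreover have "q ^ 2 - q > 0" using q_gt_1 by (simp add: power2_eq_square)
  ultimately show ?thesis using cardC by (simp only: nat_mult_eq_cancel1)
qed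

text \<open>Double counting of incident pairs, with the factor \<open>q + 1\<close> on both
  sides.\<close>

lemma card_all_Lines: "card Lines = q ^ 3 + q ^ 2 + q + 1"
proof -
  have "(\<Sum>P\<in>Points. card {L \<in> Lines. P \<subseteq> L}) = (q + 1) * card Lines"
    by (rule sum_multicount) (simp_all add: card_Points_on_line)
  then have "(q + 1) * card Points = (q + 1) * card Lines"
    by (simp add: card_Lines_through mult.commute)
  then have "card Lines = card Points"
    by (metis Suc_eq_plus1 mult_cancel1 nat.simps(3))
  then show ?thesis by (simp add: card_all_Points)
qed

text \<open>Their members have \<open>q\<close> and \<open>q^2\<close> vectors. Hence the plain
  union can serve as the vertex set of a bipartite graph, without tags.\<close>

lemma Points_Lines_disjoint: "Points \<inter> Lines = {}"
proof -
  have "q < q ^ 2" using q_gt_1 by (simp only: power2_eq_square n_less_m_mult_n)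
  then show ?thesis using card_Points card_Lines by (metis disjoint_iff less_irrefl)
qed

section \<open>Collinearity, concurrency and the absence of a duality\<close>

lemma collinear_iff:
  assumes "v \<in> V" "w \<in> V" "v \<noteq> 0" "w \<noteq> 0"
  shows "(\<exists>L\<in>Lines. span1 v \<subseteq> L \<and> span1 w \<subseteq> L) \<longleftrightarrow> sform v w = 0"
proof
  assume "\<exists>L\<in>Lines. span1 v \<subseteq> L \<and> span1 w \<subseteq> L"
  then show "sform v w = 0"
    using Lines_isotropic span1_subset_iff assms by blast
next
  assume vw: "sform v w = 0"
  show "\<exists>L\<in>Lines. span1 v \<subseteq> L \<and> span1 w \<subseteq> L"
  proof (cases "w \<in> span1 v")
    case False
    then have "span2 v w \<in> Lines" unfolding Lines_def using assms vw by blast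
    then show ?thesis
      using span1_subset_iff span2_generators[OF assms(1,2)] assms by (intro bexI[of _ "span2 v w"]) simp_all
  next
    \<comment> \<open>The two points coincide, so any of the \<open>q + 1\<close> lines through the
      point will do.\<close>
    case True
    then have "span1 w = span1 v"
      using Points_eq_span1[OF span1_Points[OF assms(1,3)] True assms(4)] by simp
    moreover have "{L \<in> Lines. span1 v \<subseteq> L} \<noteq> {}"
      using card_Lines_through[OF span1_Points[OF assms(1,3)]] by (metis add_is_0 card.empty one_neq_zero)
    ultimately show ?thesis by auto
  qed
qed

text \<open>Rescaling \<open>y\<close> makes \<open>x, y\<close> a hyperbolic pair, and completing
  it by \<open>u1\<close> and some \<open>f\<close> shows that the vectors orthogonal to both are
  the span of \<open>u1\<close> and \<open>f\<close>. As \<open>u2\<close> is not a multiple of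
  \<open>u1\<close>, these two already span that plane, so \<open>z\<close> is orthogonal to all of
  it.\<close>

lemma point_regularity:
  assumes V: "x \<in> V" "y \<in> V" "u1 \<in> V" "u2 \<in> V" "u3 \<in> V" "z \<in> V"
    and xy: "sform x y \<noteq> 0" and "u1 \<noteq> 0" and u12: "u2 \<notin> span1 u1"
    and x: "sform x u1 = 0" "sform x u2 = 0" "sform x u3 = 0"
    and y: "sform y u1 = 0" "sform y u2 = 0" "sform y u3 = 0"
    and z: "sform z u1 = 0" "sform z u2 = 0"
  shows "sform z u3 = 0"
proof -
  obtain c where c: "c \<in> F" "sform x y * c = e" using inverse_F xy V by (meson sform_F)
  let ?y = "smul c y"
  have "sform x ?y = e" using c by (simp add: sform_simps mult.commute)
  moreover have "sform ?y u1 = 0" using y by (simp add: sform_simps)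
  ultimately obtain f where f: "symplectic_basis x u1 ?y f"
    using complete_symplectic_basis[of x u1 ?y] V c x \<open>u1 \<noteq> 0\<close> by auto
  have decomp: "\<exists>s\<in>F. \<exists>t\<in>F. u = smul s u1 + smul t f" if "u \<in> V" "sform x u = 0" "sform y u = 0" for u
  proof -
    have "u \<in> lin_comb x u1 ?y f ` V" using lin_comb_bij[OF f] that by (simp add: bij_betw_def)
    then obtain x1 x2 x3 x4 where c: "Vec x1 x2 x3 x4 \<in> V" "u = lin_comb x u1 ?y f (Vec x1 x2 x3 x4)"
      by (metis imageE vec.exhaust)
    have "x3 = 0" using lin_comb_coords(3)[OF f c] that by simp
    moreover have "sform u y = 0" using that sform_commute[of u y] by simp
    then have "x1 = 0" using lin_comb_coords(1)[OF f c] by (simp add: sform_simps)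
    ultimately show ?thesis using c by auto
  qed
  obtain s t where st: "s \<in> F" "t \<in> F" "u2 = smul s u1 + smul t f" using decomp[of u2] V x y by blast
  have "t \<noteq> 0" using st u12 by (auto simp: span1_def)
  have fV: "f \<in> V" using symplectic_basis_values[OF f] by simp
  have "t * sform z f = 0" using z st by (simp add: sform_simps)
  then have "sform z f = 0" using \<open>t \<noteq> 0\<close> st fV V by (simp add: mult_eq_0_F)
  moreover obtain s' t' where "u3 = smul s' u1 + smul t' f" using decomp[of u3] V x y by blast
  ultimately show ?thesis using z by (simp add: sform_simps)
qed

text \<open>If \<open>s\<close> were nonzero, translation by \<open>s\<close> would pair off the
  elements of \<open>F\<close> and \<open>q\<close> would be even. This is where the parity of
  \<open>q\<close> enters.\<close>

lemma double_eq_0: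
  assumes "odd q" "s \<in> F" "s + s = 0"
  shows "s = 0"
proof (rule ccontr)
  assume "s \<noteq> 0"
  let ?C = "(\<lambda>x. {x, x + s}) ` F"
  have "2 * card ?C = card (\<Union>?C)"
  proof (rule card_partition)
    show "card c = 2" if "c \<in> ?C" for c using that \<open>s \<noteq> 0\<close> by auto
    have "x + s + s = x" for x using assms(3) by (simp add: add.assoc)
    then have mem: "c = {z, z + s}" if "c \<in> ?C" "z \<in> c" for c z
      using that by auto
    show "c \<inter> d = {}" if "c \<in> ?C" "d \<in> ?C" "c \<noteq> d" for c d
      using that mem by blast
  qed auto
  moreover have "\<Union>?C = F" using assms by auto
  ultimately show False using assms(1) by (metis dvd_triv_left)
qed

text \<open>Phrased with vectors so that an explicit configuration can be checked in coordinates; a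
  line counts as concurrent with itself.\<close>

definition concurrent :: "'a vec set \<Rightarrow> 'a vec set \<Rightarrow> bool" where
  "concurrent L M \<longleftrightarrow> (\<exists>v\<in>L \<inter> M. v \<noteq> 0)"

lemma concurrentI: "v \<in> L \<inter> M \<Longrightarrow> v \<noteq> 0 \<Longrightarrow> concurrent L M"
  by (auto simp: concurrent_def)

lemma concurrent_iff:
  assumes "L \<in> Lines" "M \<in> Lines"
  shows "(\<exists>P\<in>Points. P \<subseteq> L \<and> P \<subseteq> M) \<longleftrightarrow> concurrent L M"
  unfolding concurrent_def
proof
  assume "\<exists>P\<in>Points. P \<subseteq> L \<and> P \<subseteq> M"
  then obtain v where "v \<in> V" "v \<noteq> 0" "span1 v \<subseteq> L" "span1 v \<subseteq> M" by (auto simp: Points_def)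
  then show "\<exists>v\<in>L \<inter> M. v \<noteq> 0" using mem_span1 by blast
next
  assume "\<exists>v\<in>L \<inter> M. v \<noteq> 0"
  then obtain v where v: "v \<in> L" "v \<in> M" "v \<noteq> 0" by blast
  then have "v \<in> V" using Lines_subset_V assms by blast
  then show "\<exists>P\<in>Points. P \<subseteq> L \<and> P \<subseteq> M"
    using v span1_subset_iff assms span1_Points by (intro bexI[of _ "span1 v"]) auto
qed

lemma span2_in_Lines:
  assumes "v \<in> V" "w \<in> V" "v \<noteq> 0" "w \<notin> span1 v" "sform v w = 0"
  shows "span2 v w \<in> Lines"
  using assms unfolding Lines_def by blast

text \<open>With unit vectors e1, ..., e4, take the skew lines \<open>M1\<close> on e1, e2 and
  \<open>M2\<close> on e3, e4. The transversals \<open>U1\<close>, \<open>U2\<close>,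
  \<open>U3\<close> join e1, e2, e1 + e2 to their orthogonal points e4, e3, e3 - e4 of
  \<open>M2\<close>. \<open>Z\<close> joins e1 + e4 on \<open>U1\<close> to e2 + e3 on
  \<open>U2\<close>, which are orthogonal.\<close>

lemma irregular_lines:
  assumes "odd q"
  shows "\<exists>M1 M2 U1 U2 U3 Z. {M1, M2, U1, U2, U3, Z} \<subseteq> Lines \<and> U1 \<noteq> U2 \<and>
    \<not> concurrent M1 M2 \<and> \<not> concurrent Z U3 \<and>
    concurrent M1 U1 \<and> concurrent M1 U2 \<and> concurrent M1 U3 \<and> concurrent M2 U1 \<and> concurrent M2 U2 \<and>
    concurrent M2 U3 \<and> concurrent Z U1 \<and> concurrent Z U2"
proof -
  define M1 where "M1 = span2 (Vec e 0 0 0) (Vec 0 e 0 0)"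
  define M2 where "M2 = span2 (Vec 0 0 e 0) (Vec 0 0 0 e)"
  define U1 where "U1 = span2 (Vec e 0 0 0) (Vec 0 0 0 e)"
  define U2 where "U2 = span2 (Vec 0 e 0 0) (Vec 0 0 e 0)"
  define U3 where "U3 = span2 (Vec e e 0 0) (Vec 0 0 e (- e))"
  define Z where "Z = span2 (Vec e 0 0 e) (Vec 0 e e 0)"
  note defs = M1_def M2_def U1_def U2_def U3_def Z_def
  have lines: "M1 \<in> Lines" "M2 \<in> Lines" "U1 \<in> Lines" "U2 \<in> Lines" "U3 \<in> Lines" "Z \<in> Lines"
    unfolding defs by (auto intro!: span2_in_Lines simp: zero_vec_def span1_def)
  have M1: "x \<in> M1 \<longleftrightarrow> (\<exists>s\<in>F. \<exists>t\<in>F. x = Vec s t 0 0)" for x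
    unfolding M1_def span2_def by (force simp: mult.commute)
  have M2: "x \<in> M2 \<longleftrightarrow> (\<exists>s\<in>F. \<exists>t\<in>F. x = Vec 0 0 s t)" for x
    unfolding M2_def span2_def by (force simp: mult.commute)
  have U1: "x \<in> U1 \<longleftrightarrow> (\<exists>s\<in>F. \<exists>t\<in>F. x = Vec s 0 0 t)" for x
    unfolding U1_def span2_def by (force simp: mult.commute)
  have U2: "x \<in> U2 \<longleftrightarrow> (\<exists>s\<in>F. \<exists>t\<in>F. x = Vec 0 s t 0)" for x
    unfolding U2_def span2_def by (force simp: mult.commute)
  have U3: "x \<in> U3 \<longleftrightarrow> (\<exists>s\<in>F. \<exists>t\<in>F. x = Vec s s t (- t))" for x
    unfolding U3_def span2_def by (force simp: mult.commute)
  have Z: "x \<in> Z \<longleftrightarrow> (\<exists>s\<in>F. \<exists>t\<in>F. x = Vec s t t s)" for x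
    unfolding Z_def span2_def by (force simp: mult.commute)
  note mem = M1 M2 U1 U2 U3 Z
  have "Vec e 0 0 0 \<in> U1 - U2" by (auto simp: mem)
  then have "U1 \<noteq> U2" by blast
  moreover have "\<not> concurrent M1 M2" by (auto simp: concurrent_def mem zero_vec_def)
  moreover have "\<not> concurrent Z U3"
    unfolding concurrent_def
  proof clarify
    fix x assume "x \<in> Z" "x \<in> U3" "x \<noteq> 0"
    \<comment> \<open>Equating the forms \<open>Vec s t t s\<close> and
      \<open>Vec a a b (- b)\<close> makes all coordinates equal and the last one its own
      negative.\<close>
    then obtain s where s: "s \<in> F" "x = Vec s s s s" "s = - s" by (auto simp: mem)
    then have "s + s = 0" by (metis add.right_inverse)
    then show False using s double_eq_0[OF assms] \<open>x \<noteq> 0\<close> by (simp add: zero_vec_def)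
  qed
  moreover have "Vec e 0 0 0 \<in> M1 \<inter> U1" "Vec 0 e 0 0 \<in> M1 \<inter> U2" "Vec e e 0 0 \<in> M1 \<inter> U3"
    "Vec 0 0 0 e \<in> M2 \<inter> U1" "Vec 0 0 e 0 \<in> M2 \<inter> U2" "Vec 0 0 e (- e) \<in> M2 \<inter> U3"
    "Vec e 0 0 e \<in> Z \<inter> U1" "Vec 0 e e 0 \<in> Z \<inter> U2"
    by (auto simp: mem)
  then have "concurrent M1 U1" "concurrent M1 U2" "concurrent M1 U3" "concurrent M2 U1" "concurrent M2 U2"
    "concurrent M2 U3" "concurrent Z U1" "concurrent Z U2"
    by - (erule concurrentI, simp add: zero_vec_def)+
  ultimately show ?thesis
    using lines by (intro exI[of _ M1] exI[of _ M2] exI[of _ U1] exI[of _ U2] exI[of _ U3] exI[of _ Z]) simp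
qed

text \<open>Choosing a vector \<open>h L\<close> generating the point \<open>f L\<close> turns
  concurrency of lines into orthogonality of vectors. The image of the irregular configuration of
  lines then contradicts \<open>point_regularity\<close>.\<close>

lemma no_duality:
  assumes "odd q"
    and f_Points: "f ` Points = Lines" and f_Lines: "\<And>L. L \<in> Lines \<Longrightarrow> f L \<in> Points"
    and inj: "inj_on f Lines"
    and incidence: "\<And>P L. P \<in> Points \<Longrightarrow> L \<in> Lines \<Longrightarrow> P \<subseteq> L \<longleftrightarrow> f L \<subseteq> f P"
  shows False
proof -
  have "\<forall>L\<in>Lines. \<exists>v. v \<in> V \<and> v \<noteq> 0 \<and> f L = span1 v"
    using f_Lines by (auto simp: Points_def)
  then obtain h where h: "\<And>L. L \<in> Lines \<Longrightarrow> h L \<in> V \<and> h L \<noteq> 0 \<and> f L = span1 (h L)"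
    by metis
  have conc: "concurrent L M \<longleftrightarrow> sform (h L) (h M) = 0" if LM: "L \<in> Lines" "M \<in> Lines" for L M
  proof -
    have "concurrent L M \<longleftrightarrow> (\<exists>P\<in>Points. f L \<subseteq> f P \<and> f M \<subseteq> f P)"
      using concurrent_iff[OF LM] incidence LM by simp
    \<comment> \<open>As \<open>f\<close> maps the points onto the lines, a common point of
      \<open>L\<close> and \<open>M\<close> becomes a common line of their images.\<close>
    also have "\<dots> \<longleftrightarrow> (\<exists>N\<in>f ` Points. f L \<subseteq> N \<and> f M \<subseteq> N)"
      by blast
    also have "\<dots> \<longleftrightarrow> (\<exists>N\<in>Lines. span1 (h L) \<subseteq> N \<and> span1 (h M) \<subseteq> N)"
      using h LM by (simp add: f_Points)
    finally show ?thesis using collinear_iff h LM by simp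
  qed
  obtain M1 M2 U1 U2 U3 Z where lines: "{M1, M2, U1, U2, U3, Z} \<subseteq> Lines" and U12: "U1 \<noteq> U2"
    and skew: "\<not> concurrent M1 M2" "\<not> concurrent Z U3"
    and meet: "concurrent M1 U1 \<and> concurrent M1 U2 \<and> concurrent M1 U3 \<and> concurrent M2 U1 \<and> concurrent M2 U2 \<and>
    concurrent M2 U3 \<and> concurrent Z U1 \<and> concurrent Z U2"
    using irregular_lines[OF \<open>odd q\<close>] by (elim exE conjE) (rule that; assumption | simp)
  have V: "h M1 \<in> V" "h M2 \<in> V" "h U1 \<in> V" "h U2 \<in> V" "h U3 \<in> V" "h Z \<in> V" "h U1 \<noteq> 0" "h U2 \<noteq> 0"
    using lines h by auto
  have "h U2 \<notin> span1 (h U1)"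
  proof
    assume "h U2 \<in> span1 (h U1)"
    then have "span1 (h U1) = span1 (h U2)"
      by (rule Points_eq_span1[OF span1_Points[OF V(3,7)] _ V(8)])
    then have "f U1 = f U2" using lines h by simp
    then show False using U12 lines inj_onD[OF inj, of U1 U2] by simp
  qed
  moreover have "sform (h M1) (h M2) \<noteq> 0" "sform (h Z) (h U3) \<noteq> 0"
    using skew lines conc[of M1 M2] conc[of Z U3] by auto
  moreover have "sform (h M1) (h U1) = 0" "sform (h M1) (h U2) = 0" "sform (h M1) (h U3) = 0"
    "sform (h M2) (h U1) = 0" "sform (h M2) (h U2) = 0" "sform (h M2) (h U3) = 0"
    "sform (h Z) (h U1) = 0" "sform (h Z) (h U2) = 0"
    using meet lines by (simp_all add: conc)
  ultimately show False
    using point_regularity[OF V(1-6) _ V(7)] by blast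
qed

end

text \<open>The factor at \<open>q\<close> is embedded as the elements of the product that vanish at
  every other index. Its unit is the indicator of the index \<open>q\<close>, which explains the
  separate \<open>e\<close> in the locale.\<close>

lemma ex_finite_subfield:
  assumes "primepow q"
  shows "\<exists>(F :: field_product set) e. finite_subfield F e \<and> card F = q"
proof -
  interpret Kq: field "prime_power_field q" by (rule prime_power_field)
  have cr: "cring (prime_power_field r)" for r
    using prime_power_field(1) by (simp add: field_def domain_def)
  define emb where "emb a = Abs_field_product (\<lambda>r. if r = q then a else \<zero>\<^bsub>prime_power_field r\<^esub>)" for a
  have comp: "component (emb a) r = (if r = q then a else \<zero>\<^bsub>prime_power_field r\<^esub>)" if "a \<in> carrier (prime_power_field q)" for a r
  proof -
    have "(\<lambda>r. if r = q then a else \<zero>\<^bsub>prime_power_field r\<^esub>) \<in> {f. \<forall>q. f q \<in> carrier (prime_power_field q)}"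
      using that by (auto simp: cring.cring_simprules[OF cr])
    then show ?thesis unfolding emb_def by (simp add: Abs_field_product_inverse)
  qed
  let ?C = "carrier (prime_power_field q)" and ?F = "emb ` carrier (prime_power_field q)"
  have add: "emb a + emb b = emb (a \<oplus>\<^bsub>prime_power_field q\<^esub> b)" and mult: "emb a * emb b = emb (a \<otimes>\<^bsub>prime_power_field q\<^esub> b)"
    if "a \<in> ?C" "b \<in> ?C" for a b
    using that by (auto intro!: field_product_eqI simp: comp component_simps cring.cring_simprules[OF cr])
  have uminus: "- emb a = emb (\<ominus>\<^bsub>prime_power_field q\<^esub> a)" if "a \<in> ?C" for a
    using that by (auto intro!: field_product_eqI simp: comp component_simps cring.cring_simprules[OF cr])
  have zero: "0 = emb \<zero>\<^bsub>prime_power_field q\<^esub>"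
    by (auto intro!: field_product_eqI simp: comp component_simps)
  have inj: "inj_on emb ?C"
    by (rule inj_onI) (metis comp)
  have card: "card ?F = q"
    using card_image[OF inj] prime_power_field(2)[OF assms] by simp
  moreover have "finite ?F"
    using card primepow_gt_0_nat[OF assms] by (metis card_ge_0_finite)
  moreover have "finite_subfield ?F (emb \<one>\<^bsub>prime_power_field q\<^esub>)"
  proof
    show "emb \<one>\<^bsub>prime_power_field q\<^esub> \<noteq> 0"
      using inj_onD[OF inj, of "\<one>\<^bsub>prime_power_field q\<^esub>" "\<zero>\<^bsub>prime_power_field q\<^esub>"] unfolding zero by auto
    fix x assume x: "x \<in> ?F"
    then obtain a where a: "a \<in> ?C" "x = emb a" by blast
    show "- x \<in> ?F" using a by (simp add: uminus)
    show "emb \<one>\<^bsub>prime_power_field q\<^esub> * x = x" using a by (simp add: mult)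
    show "\<exists>y\<in>?F. x * y = emb \<one>\<^bsub>prime_power_field q\<^esub>" if "x \<noteq> 0"
    proof -
      have "a \<in> Units (prime_power_field q)" using that a zero by (auto simp: Kq.field_Units)
      then have "inv\<^bsub>prime_power_field q\<^esub> a \<in> ?C" "x * emb (inv\<^bsub>prime_power_field q\<^esub> a) = emb \<one>\<^bsub>prime_power_field q\<^esub>"
        using a by (auto simp: mult)
      then show ?thesis by blast
    qed
    fix y assume "y \<in> ?F"
    then obtain b where b: "b \<in> ?C" "y = emb b" by blast
    show "x + y \<in> ?F" "x * y \<in> ?F" using a b by (auto simp: add mult)
  qed (use \<open>finite ?F\<close> zero in auto)
  ultimately show ?thesis by blast
qed

section \<open>Graph isomorphisms\<close>

definition isomorphism :: "'a pair_pre_digraph \<Rightarrow> 'b pair_pre_digraph \<Rightarrow> ('a \<Rightarrow> 'b) \<Rightarrow> bool" where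
  "isomorphism G H h \<longleftrightarrow> bij_betw h (pverts G) (pverts H) \<and>
     (\<forall>u\<in>pverts G. \<forall>v\<in>pverts G. (h u, h v) \<in> parcs H \<longleftrightarrow> (u, v) \<in> parcs G)"

lemma automorphism_iff_isomorphism: "automorphism G f \<longleftrightarrow> isomorphism G G f"
  by (simp add: automorphism_def isomorphism_def)

lemma isomorphism_comp:
  assumes "isomorphism G H f" "isomorphism H K g"
  shows "isomorphism G K (g \<circ> f)"
  using assms bij_betw_trans[of f "pverts G" "pverts H" g "pverts K"]
  by (auto simp: isomorphism_def dest: bij_betwE)

lemma isomorphism_inv:
  assumes "isomorphism G H h"
  shows "isomorphism H G (inv_into (pverts G) h)"
proof -
  let ?k = "inv_into (pverts G) h"
  have h: "bij_betw h (pverts G) (pverts H)" using assms by (simp add: isomorphism_def)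
  have k: "?k u \<in> pverts G" "h (?k u) = u" if "u \<in> pverts H" for u
    using bij_betw_inv_into[OF h] bij_betw_inv_into_right[OF h] that by (auto dest: bij_betwE)
  have "(?k u, ?k v) \<in> parcs G \<longleftrightarrow> (u, v) \<in> parcs H" if "u \<in> pverts H" "v \<in> pverts H" for u v
    using assms k[OF that(1)] k[OF that(2)] unfolding isomorphism_def by metis
  then show ?thesis
    using bij_betw_inv_into[OF h] by (simp add: isomorphism_def)
qed

lemma edges_subset: "pair_wf_digraph G \<Longrightarrow> d \<in> edges G \<Longrightarrow> d \<subseteq> pverts G"
  by (auto simp: edges_def dest: pair_wf_digraph.in_arcsD1 pair_wf_digraph.in_arcsD2)

text \<open>Any edge is taken back to the base edge \<open>d\<close> by an inverse and from there to
  any other.\<close>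

lemma edge_transitiveI:
  assumes "pair_wf_digraph G" "d \<in> edges G" "\<And>d'. d' \<in> edges G \<Longrightarrow> \<exists>f. automorphism G f \<and> f ` d = d'"
  shows "edge_transitive G"
  unfolding edge_transitive_def
proof (intro ballI)
  fix d1 d2 assume "d1 \<in> edges G" "d2 \<in> edges G"
  then obtain f g where f: "automorphism G f" "f ` d = d1" and g: "automorphism G g" "g ` d = d2"
    using assms(3) by meson
  let ?k = "inv_into (pverts G) f"
  have "?k ` d1 = d"
    using f edges_subset[OF assms(1,2)] unfolding f(2)[symmetric]
    by (intro inv_into_image_cancel) (auto simp: automorphism_def bij_betw_def)
  then have "(g \<circ> ?k) ` d1 = d2"
    using g(2) unfolding image_comp [symmetric] by simp
  moreover have "automorphism G (g \<circ> ?k)"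
    using f g isomorphism_comp isomorphism_inv unfolding automorphism_iff_isomorphism by blast
  ultimately show "\<exists>f. automorphism G f \<and> f ` d1 = d2" by blast
qed

section \<open>Transport of graph properties along an isomorphism\<close>

locale graph_isomorphism = G: pair_wf_digraph G + H: pair_wf_digraph H
  for G :: "'a pair_pre_digraph" and H :: "'b pair_pre_digraph" +
  fixes h :: "'a \<Rightarrow> 'b"
  assumes iso: "isomorphism G H h"
begin

abbreviation "k \<equiv> inv_into (pverts G) h"

lemma bij: "bij_betw h (pverts G) (pverts H)"
  using iso by (simp add: isomorphism_def)

lemma arcs_iff: "u \<in> pverts G \<Longrightarrow> v \<in> pverts G \<Longrightarrow> (h u, h v) \<in> parcs H \<longleftrightarrow> (u, v) \<in> parcs G"
  using iso by (simp add: isomorphism_def)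

lemma h_image: "h ` pverts G = pverts H"
  using bij by (simp add: bij_betw_def)

lemma k_h: "u \<in> pverts G \<Longrightarrow> k (h u) = u"
  using bij_betw_inv_into_left[OF bij] .

lemma conjugate: "automorphism G f \<Longrightarrow> automorphism H (h \<circ> f \<circ> k)"
  "automorphism H g \<Longrightarrow> automorphism G (k \<circ> g \<circ> h)"
  unfolding automorphism_iff_isomorphism using iso isomorphism_inv[OF iso] by (blast intro: isomorphism_comp)+

lemma neighbourhood_iso: "v \<in> pverts G \<Longrightarrow> neighbourhood H (h v) = h ` neighbourhood G v"
proof (intro equalityI subsetI)
  fix y assume v: "v \<in> pverts G" and "y \<in> neighbourhood H (h v)"
  then have "(h v, y) \<in> parcs H" by (simp add: neighbourhood_def)
  then obtain u where "u \<in> pverts G" "y = h u" using H.in_arcsD2 h_image by blast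
  then show "y \<in> h ` neighbourhood G v"
    using \<open>(h v, y) \<in> parcs H\<close> arcs_iff v by (auto simp: neighbourhood_def)
next
  fix y assume "v \<in> pverts G" "y \<in> h ` neighbourhood G v"
  then obtain u where "(v, u) \<in> parcs G" "y = h u" by (auto simp: neighbourhood_def)
  then show "y \<in> neighbourhood H (h v)"
    using arcs_iff[of v u] G.in_arcsD1 G.in_arcsD2 by (auto simp: neighbourhood_def)
qed

lemma neighbourhood_subset: "neighbourhood G v \<subseteq> pverts G"
  by (auto simp: neighbourhood_def dest: G.in_arcsD2)

lemma h_inj: "inj_on h (pverts G)"
  using bij by (simp add: bij_betw_def)

lemma regular_iso: "regular G d \<Longrightarrow> regular H d"
  unfolding regular_def h_image[symmetric]
  using card_image[OF inj_on_subset[OF h_inj neighbourhood_subset]] by (simp add: neighbourhood_iso)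

lemma worthy_iso: "worthy G \<Longrightarrow> worthy H"
  unfolding worthy_def h_image[symmetric]
  using inj_on_image_eq_iff[OF h_inj neighbourhood_subset neighbourhood_subset]
  by (auto simp: neighbourhood_iso)

lemma vertex_transitive_iso:
  assumes "vertex_transitive H"
  shows "vertex_transitive G"
  unfolding vertex_transitive_def
proof (intro ballI)
  fix u v assume uv: "u \<in> pverts G" "v \<in> pverts G"
  then obtain f where "automorphism H f" "f (h u) = h v"
    using assms h_image unfolding vertex_transitive_def by blast
  then show "\<exists>g. automorphism G g \<and> g u = v"
    using uv k_h conjugate(2) by (intro exI[of _ "k \<circ> f \<circ> h"]) auto
qed

lemma edges_iso:
  assumes "d \<in> edges H"
  shows "\<exists>d'\<in>edges G. d = h ` d'"
proof -
  obtain x y where xy: "d = {x, y}" "(x, y) \<in> parcs H" using assms by (auto simp: edges_def)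
  then obtain u v where uv: "x = h u" "y = h v" "u \<in> pverts G" "v \<in> pverts G"
    using H.in_arcsD1 H.in_arcsD2 h_image by (metis imageE)
  then have "{u, v} \<in> edges G" using xy arcs_iff by (auto simp: edges_def)
  then show ?thesis using xy uv by (intro bexI[of _ "{u, v}"]) auto
qed

lemma edge_transitive_iso:
  assumes "edge_transitive G"
  shows "edge_transitive H"
  unfolding edge_transitive_def
proof (intro ballI)
  fix d1 d2 assume "d1 \<in> edges H" "d2 \<in> edges H"
  then obtain c1 c2 where c: "c1 \<in> edges G" "d1 = h ` c1" "c2 \<in> edges G" "d2 = h ` c2"
    using edges_iso by meson
  then obtain f where f: "automorphism G f" "f ` c1 = c2"
    using assms unfolding edge_transitive_def by blast
  have "k ` d1 = c1"
    unfolding c(2) using h_inj edges_subset[OF G.pair_wf_digraph_axioms c(1)] by (rule inv_into_image_cancel)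
  then have "(h \<circ> f \<circ> k) ` d1 = d2"
    using c f unfolding image_comp [symmetric] by simp
  then show "\<exists>g. automorphism H g \<and> g ` d1 = d2"
    using conjugate(1)[OF f(1)] by blast
qed

lemma rtrancl_iso:
  assumes "(u, v) \<in> (parcs G)\<^sup>*"
  shows "(h u, h v) \<in> (parcs H)\<^sup>*"
  using assms
proof induction
  case (step v w)
  then have "(h v, h w) \<in> parcs H" using arcs_iff G.in_arcsD1 G.in_arcsD2 by blast
  with step.IH show ?case by simp
qed simp

end

text \<open>Connectedness in the library means strong connectedness of the symmetric closure, whose
  arcs include those of \<open>G\<close>.\<close>

lemma connectedI:
  assumes "pair_graph G" "pverts G \<noteq> {}" "\<And>u v. u \<in> pverts G \<Longrightarrow> v \<in> pverts G \<Longrightarrow> (u, v) \<in> (parcs G)\<^sup>*"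
  shows "Digraph_Component.connected (with_proj G)"
proof -
  interpret pair_graph G by fact
  have sub: "parcs G \<subseteq> parcs (mk_symmetric (with_proj G))"
    by (auto simp: parcs_mk_symmetric)
  interpret S: pair_wf_digraph "mk_symmetric (with_proj G)"
    by (rule wellformed_mk_symmetric)
  show ?thesis
    unfolding Digraph_Component.connected_def strongly_connected_def
    using assms(2,3) rtrancl_mono[OF sub] by (auto simp: S.reachable_conv)
qed

text \<open>Serves to rename vertices that are sets of vectors into natural numbers.\<close>

definition image_graph :: "('a \<Rightarrow> 'b) \<Rightarrow> 'a pair_pre_digraph \<Rightarrow> 'b pair_pre_digraph" where
  "image_graph h G = \<lparr>pverts = h ` pverts G, parcs = map_prod h h ` parcs G\<rparr>"

lemma image_graph_simps [simp]:
  "pverts (image_graph h G) = h ` pverts G" "parcs (image_graph h G) = map_prod h h ` parcs G"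
  by (simp_all add: image_graph_def)

lemma pair_graph_image_graph:
  assumes "pair_graph G" "inj_on h (pverts G)"
  shows "pair_graph (image_graph h G)"
proof -
  interpret pair_graph G by fact
  have "sym (parcs G)" using pair_sym_arcs by (simp add: symmetric_def)
  then have sym: "symmetric (with_proj (image_graph h G))"
    by (force simp: symmetric_def sym_def)
  show ?thesis
  proof
    fix a assume "a \<in> parcs (image_graph h G)"
    then show "fst a \<noteq> snd a"
      using pair_no_loops in_arcsD1 in_arcsD2 inj_onD[OF assms(2)] by fastforce
  qed (use sym pair_finite_verts pair_finite_arcs in_arcsD1 in_arcsD2 in auto)
qed

lemma graph_isomorphism_image_graph:
  assumes "pair_graph G" "inj_on h (pverts G)"
  shows "graph_isomorphism G (image_graph h G) h"
proof -
  interpret G: pair_graph G by fact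
  interpret H: pair_graph "image_graph h G" by (rule pair_graph_image_graph[OF assms])
  have "(h u, h v) \<in> map_prod h h ` parcs G \<longleftrightarrow> (u, v) \<in> parcs G" if "u \<in> pverts G" "v \<in> pverts G" for u v
    using that inj_onD[OF assms(2)] by (auto dest: G.in_arcsD1 G.in_arcsD2 intro: rev_image_eqI) (metis G.in_arcsD1 G.in_arcsD2)
  then show ?thesis
    using assms(2) by unfold_locales (simp add: isomorphism_def bij_betw_def)
qed

lemma ex_nat_graph:
  assumes "pair_graph G" "pverts G \<noteq> {}" "\<And>u v. u \<in> pverts G \<Longrightarrow> v \<in> pverts G \<Longrightarrow> (u, v) \<in> (parcs G)\<^sup>*"
    and "worthy G" "regular G d" "edge_transitive G" "\<not> vertex_transitive G"
  shows "\<exists>H :: nat pair_pre_digraph. pair_graph H \<and> Digraph_Component.connected (with_proj H) \<and> worthy H \<and>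
    semi_symmetric H \<and> card (pverts H) = card (pverts G) \<and> regular H d"
proof -
  interpret G: pair_graph G by fact
  obtain h :: "_ \<Rightarrow> nat" where h: "inj_on h (pverts G)"
    using finite_imp_inj_to_nat_seg[OF G.pair_finite_verts] by blast
  let ?H = "image_graph h G"
  interpret iso: graph_isomorphism G ?H h by (rule graph_isomorphism_image_graph[OF assms(1) h])
  have H: "pair_graph ?H" by (rule pair_graph_image_graph[OF assms(1) h])
  have "Digraph_Component.connected (with_proj ?H)"
    using assms(2,3) iso.rtrancl_iso by (intro connectedI[OF H]) auto
  moreover have "semi_symmetric ?H"
    unfolding semi_symmetric_def
    using assms iso.regular_iso iso.edge_transitive_iso iso.vertex_transitive_iso by blast
  moreover have "card (pverts ?H) = card (pverts G)"
    using card_image[OF h] by simp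
  ultimately show ?thesis
    using H iso.worthy_iso[OF assms(4)] iso.regular_iso[OF assms(5)] by blast
qed

section \<open>The non-incidence graph\<close>

context finite_subfield
begin

definition nonincidence_graph :: "'a vec set pair_pre_digraph" where
  "nonincidence_graph = \<lparr>pverts = Points \<union> Lines,
     parcs = {(u, v). u \<in> Points \<and> v \<in> Lines \<and> \<not> u \<subseteq> v \<or> u \<in> Lines \<and> v \<in> Points \<and> \<not> v \<subseteq> u}\<rparr>"

abbreviation "\<Gamma> \<equiv> nonincidence_graph"

lemma pverts_graph [simp]: "pverts \<Gamma> = Points \<union> Lines"
  by (simp add: nonincidence_graph_def)

lemma disjoint: "P \<in> Points \<Longrightarrow> P \<notin> Lines" "L \<in> Lines \<Longrightarrow> L \<notin> Points"
  using Points_Lines_disjoint by auto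

lemma arc_point_line: "P \<in> Points \<Longrightarrow> (P, L) \<in> parcs \<Gamma> \<longleftrightarrow> L \<in> Lines \<and> \<not> P \<subseteq> L"
  and arc_line_point: "L \<in> Lines \<Longrightarrow> (L, P) \<in> parcs \<Gamma> \<longleftrightarrow> P \<in> Points \<and> \<not> P \<subseteq> L"
  by (simp_all add: nonincidence_graph_def disjoint)

lemma arcs_sym: "(u, v) \<in> parcs \<Gamma> \<Longrightarrow> (v, u) \<in> parcs \<Gamma>"
  by (auto simp: nonincidence_graph_def)

lemma arc_verts: "(u, v) \<in> parcs \<Gamma> \<Longrightarrow> u \<in> Points \<union> Lines \<and> v \<in> Points \<union> Lines"
  by (auto simp: nonincidence_graph_def)

lemma pair_graph: "pair_graph \<Gamma>"
proof
  have "parcs \<Gamma> \<subseteq> (Points \<union> Lines) \<times> (Points \<union> Lines)"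
    using arc_verts by auto
  then show "finite (parcs \<Gamma>)" by (rule finite_subset) simp
  show "symmetric (with_proj \<Gamma>)"
    using arcs_sym by (auto simp: symmetric_def intro: symI)
  fix a assume "a \<in> parcs \<Gamma>"
  then show "fst a \<noteq> snd a" "fst a \<in> pverts \<Gamma>" "snd a \<in> pverts \<Gamma>"
    using disjoint by (auto simp: nonincidence_graph_def)
qed simp

lemma pair_wf_digraph: "pair_wf_digraph \<Gamma>"
  using pair_graph by (simp add: pair_graph_def pair_digraph_def pair_fin_digraph_def)

section \<open>Order, valency, worthiness and connectedness\<close>

lemma neighbourhood_point: "P \<in> Points \<Longrightarrow> neighbourhood \<Gamma> P = Lines - {L \<in> Lines. P \<subseteq> L}"
  and neighbourhood_line: "L \<in> Lines \<Longrightarrow> neighbourhood \<Gamma> L = Points - {P \<in> Points. P \<subseteq> L}"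
  unfolding neighbourhood_def by (simp_all only: arc_point_line arc_line_point) blast+

lemma regular: "regular \<Gamma> (q ^ 3 + q ^ 2)"
  unfolding regular_def
proof
  fix v assume "v \<in> pverts \<Gamma>"
  then consider "v \<in> Points" | "v \<in> Lines" by auto
  then show "card (neighbourhood \<Gamma> v) = q ^ 3 + q ^ 2"
  proof cases
    case 1
    then show ?thesis
      by (simp add: neighbourhood_point card_Diff_subset card_all_Lines card_Lines_through)
  next
    case 2
    then show ?thesis
      by (simp add: neighbourhood_line card_Diff_subset card_all_Points card_Points_on_line)
  qed
qed

lemma neighbourhood_nonempty:
  assumes "v \<in> pverts \<Gamma>"
  shows "neighbourhood \<Gamma> v \<noteq> {}"
proof
  assume "neighbourhood \<Gamma> v = {}"
  moreover have "card (neighbourhood \<Gamma> v) = q ^ 3 + q ^ 2"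
    using regular assms by (simp add: regular_def)
  ultimately show False using q_gt_1 by auto
qed

lemma card_vertices: "card (pverts \<Gamma>) = 2 * (q ^ 3 + q ^ 2 + q + 1)"
proof -
  have "card (Points \<union> Lines) = card Points + card Lines"
    by (rule card_Un_disjoint[OF finite_Points finite_Lines Points_Lines_disjoint])
  then show ?thesis unfolding pverts_graph card_all_Points card_all_Lines by (simp only: mult_2)
qed

text \<open>At most \<open>2 * (q + 1)\<close> lines contain one of the two points, fewer than there
  are lines. The result is a common neighbour of any two points, needed both for connectedness and
  for showing that an automorphism cannot mix the classes.\<close>

lemma ex_line_avoiding:
  assumes "P \<in> Points" "P' \<in> Points"
  shows "\<exists>L\<in>Lines. \<not> P \<subseteq> L \<and> \<not> P' \<subseteq> L"
proof (rule ccontr)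
  assume "\<not> ?thesis"
  then have "Lines \<subseteq> {L \<in> Lines. P \<subseteq> L} \<union> {L \<in> Lines. P' \<subseteq> L}" by blast
  then have "card Lines \<le> card ({L \<in> Lines. P \<subseteq> L} \<union> {L \<in> Lines. P' \<subseteq> L})"
    by (intro card_mono) auto
  also have "\<dots> \<le> (q + 1) + (q + 1)"
    using card_Un_le[of "{L \<in> Lines. P \<subseteq> L}" "{L \<in> Lines. P' \<subseteq> L}"] assms by (simp only: card_Lines_through)
  finally have "q ^ 3 + q ^ 2 \<le> q + 1" by (simp add: card_all_Lines)
  moreover have "q < q ^ 2" "1 < q ^ 3"
    using one_less_power[OF q_gt_1, of 3] q_gt_1 by (simp_all add: power2_eq_square)
  ultimately show False by linarith
qed

text \<open>Otherwise all \<open>q + 1\<close> lines through \<open>P\<close> would be the single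
  line joining \<open>P\<close> and \<open>P'\<close>.\<close>

lemma ex_line_through_only_one:
  assumes "P \<in> Points" "P' \<in> Points" "P \<noteq> P'"
  shows "\<exists>L\<in>Lines. P \<subseteq> L \<and> \<not> P' \<subseteq> L"
proof (rule ccontr)
  assume neg: "\<not> ?thesis"
  obtain p p' where p: "P = span1 p" "p \<in> V" "p \<noteq> 0" and p': "P' = span1 p'" "p' \<in> V" "p' \<noteq> 0"
    using assms by (auto simp: Points_def)
  have "p' \<notin> span1 p"
  proof
    assume "p' \<in> span1 p"
    then have "span1 p = span1 p'" by (rule Points_eq_span1[OF span1_Points[OF p(2,3)] _ p'(3)])
    then show False using assms p p' by simp
  qed
  then have "L = span2 p p'" if "L \<in> Lines" "P \<subseteq> L" for L
    using that neg span1_subset_iff p p' by (intro Lines_eq_span2) auto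
  then have "{L \<in> Lines. P \<subseteq> L} \<subseteq> {span2 p p'}" by blast
  then have "card {L \<in> Lines. P \<subseteq> L} \<le> card {span2 p p'}" by (rule card_mono[rotated]) simp
  then show False using card_Lines_through[OF assms(1)] q_gt_1 by simp
qed

lemma Lines_eqI:
  assumes "L \<in> Lines" "M \<in> Lines" "\<And>P. P \<in> Points \<Longrightarrow> P \<subseteq> L \<longleftrightarrow> P \<subseteq> M"
  shows "L = M"
proof -
  have "x \<in> M" if LM: "L \<in> Lines" "M \<in> Lines" "\<And>P. P \<in> Points \<Longrightarrow> P \<subseteq> L \<longleftrightarrow> P \<subseteq> M" and x: "x \<in> L" for x L M
  proof -
    have "x \<in> V" using x Lines_subset_V LM by blast
    obtain y where "y \<in> M" using card_Lines[OF LM(2)] q_gt_1 by fastforce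
    then have "0 \<in> M" using Lines_smul[OF LM(2) _ zero_F] by auto
    then show ?thesis
      using LM(3)[OF span1_Points[OF \<open>x \<in> V\<close>]] span1_subset_iff \<open>x \<in> V\<close> x LM(1,2) by (cases "x = 0") auto
  qed
  from this[OF assms] this[OF assms(2,1)] show ?thesis using assms(3) by blast
qed

lemma worthy: "worthy \<Gamma>"
  unfolding worthy_def
proof (intro ballI impI notI)
  fix u v assume uv: "u \<in> pverts \<Gamma>" "v \<in> pverts \<Gamma>" "u \<noteq> v" and eq: "neighbourhood \<Gamma> u = neighbourhood \<Gamma> v"
  have ne: "neighbourhood \<Gamma> u \<noteq> {}"
    by (rule neighbourhood_nonempty[OF uv(1)])
  consider "u \<in> Points" "v \<in> Points" | "u \<in> Lines" "v \<in> Lines" | "u \<in> Points" "v \<in> Lines" | "u \<in> Lines" "v \<in> Points"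
    using uv by auto
  then show False
  proof cases
    case 1
    obtain L where "L \<in> Lines" "u \<subseteq> L" "\<not> v \<subseteq> L"
      using ex_line_through_only_one[OF 1 uv(3)] by blast
    then have "L \<notin> neighbourhood \<Gamma> u" "L \<in> neighbourhood \<Gamma> v"
      unfolding neighbourhood_point[OF 1(1)] neighbourhood_point[OF 1(2)] by blast+
    then show False using eq by simp
  next
    case 2
    have "P \<subseteq> u \<longleftrightarrow> P \<subseteq> v" if "P \<in> Points" for P
      using that eq unfolding neighbourhood_line[OF 2(1)] neighbourhood_line[OF 2(2)] by blast
    then show False using Lines_eqI[OF 2] uv(3) by blast
  next
    \<comment> \<open>A point has only lines as neighbours and a line only points, so a shared
      neighbourhood would be empty.\<close>
    case 3
    then show False
      using eq ne Points_Lines_disjoint unfolding neighbourhood_point[OF 3(1)] neighbourhood_line[OF 3(2)] by blast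
  next
    case 4
    then show False
      using eq ne Points_Lines_disjoint unfolding neighbourhood_line[OF 4(1)] neighbourhood_point[OF 4(2)] by blast
  qed
qed

lemma reachable_arcs:
  assumes "u \<in> pverts \<Gamma>" "v \<in> pverts \<Gamma>"
  shows "(u, v) \<in> (parcs \<Gamma>)\<^sup>*"
proof -
  have pp: "(P, P') \<in> (parcs \<Gamma>)\<^sup>*" if PP: "P \<in> Points" "P' \<in> Points" for P P'
  proof -
    obtain L where "L \<in> Lines" "\<not> P \<subseteq> L" "\<not> P' \<subseteq> L" using ex_line_avoiding[OF PP] by blast
    then have "(P, L) \<in> parcs \<Gamma>" "(L, P') \<in> parcs \<Gamma>"
      using PP by (simp_all add: arc_point_line arc_line_point)
    then show ?thesis by (meson converse_rtrancl_into_rtrancl r_into_rtrancl)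
  qed
  \<comment> \<open>Every vertex is linked both ways to some point, itself or a neighbour; only
    pairs of points remain.\<close>
  have ex: "\<exists>P\<in>Points. (u, P) \<in> (parcs \<Gamma>)\<^sup>* \<and> (P, u) \<in> (parcs \<Gamma>)\<^sup>*" if "u \<in> pverts \<Gamma>" for u
  proof (cases "u \<in> Points")
    case False
    then have u: "u \<in> Lines" using that by simp
    then obtain P where "(u, P) \<in> parcs \<Gamma>"
      using neighbourhood_nonempty[of u] by (auto simp: neighbourhood_def)
    then show ?thesis using u arcs_sym[of u P] arc_line_point[OF u] by (intro bexI[of _ P]) auto
  qed blast
  show ?thesis using ex[OF assms(1)] ex[OF assms(2)] pp by (meson rtrancl_trans)
qed

section \<open>Edge-transitivity and the failure of vertex-transitivity\<close>

lemma isometry_automorphism: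
  assumes "isometry g"
  shows "automorphism \<Gamma> ((`) g)"
proof -
  have inj: "inj_on g V" using assms by (simp add: isometry_def bij_betw_def)
  have VV: "u \<subseteq> V" if "u \<in> Points \<union> Lines" for u
    using that Points_subset_V Lines_subset_V by blast
  have "inj_on ((`) g) (Points \<union> Lines)"
    using inj_on_image_eq_iff[OF inj] VV by (auto intro!: inj_onI)
  moreover have "(`) g ` (Points \<union> Lines) \<subseteq> Points \<union> Lines"
    using isometry_Points[OF assms] isometry_Lines[OF assms] by auto
  ultimately have bij: "bij_betw ((`) g) (Points \<union> Lines) (Points \<union> Lines)"
    by (simp add: bij_betw_def endo_inj_surj)
  have "(g ` u, g ` v) \<in> parcs \<Gamma> \<longleftrightarrow> (u, v) \<in> parcs \<Gamma>" if uv: "u \<in> Points \<union> Lines" "v \<in> Points \<union> Lines" for u v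
  proof -
    have P: "g ` u \<in> Points \<longleftrightarrow> u \<in> Points" "g ` u \<in> Lines \<longleftrightarrow> u \<in> Lines" if "u \<in> Points \<union> Lines" for u
      using that isometry_Points[OF assms] isometry_Lines[OF assms] disjoint by blast+
    have "g ` x \<subseteq> g ` y \<longleftrightarrow> x \<subseteq> y" if "x \<in> Points \<union> Lines" "y \<in> Points \<union> Lines" for x y
      using inj_on_image_mem_iff[OF inj _ VV[OF that(2)]] VV[OF that(1)] by blast
    then show ?thesis
      using P[OF uv(1)] P[OF uv(2)] uv
      by (simp add: nonincidence_graph_def)
  qed
  with bij show ?thesis by (simp add: automorphism_def)
qed

lemma lin_comb_standard_basis:
  assumes "symplectic_basis a b c d"
  shows "lin_comb a b c d (Vec e 0 0 0) = a" "lin_comb a b c d (Vec 0 e 0 0) = b" "lin_comb a b c d (Vec 0 0 e 0) = c"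
  using symplectic_basis_values[OF assms] by simp_all

lemma edges_graph: "edges \<Gamma> = {{P, L} | P L. P \<in> Points \<and> L \<in> Lines \<and> \<not> P \<subseteq> L}"
proof
  show "edges \<Gamma> \<subseteq> {{P, L} | P L. P \<in> Points \<and> L \<in> Lines \<and> \<not> P \<subseteq> L}"
  proof
    fix d assume "d \<in> edges \<Gamma>"
    then obtain u v where d: "d = {u, v}" and uv: "(u, v) \<in> parcs \<Gamma>" by (auto simp: edges_def)
    then consider "u \<in> Points" "v \<in> Lines" "\<not> u \<subseteq> v" | "v \<in> Points" "u \<in> Lines" "\<not> v \<subseteq> u"
      by (auto simp: nonincidence_graph_def)
    then show "d \<in> {{P, L} | P L. P \<in> Points \<and> L \<in> Lines \<and> \<not> P \<subseteq> L}"
      using d insert_commute[of u v "{}"] by cases blast+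
  qed
  show "{{P, L} | P L. P \<in> Points \<and> L \<in> Lines \<and> \<not> P \<subseteq> L} \<subseteq> edges \<Gamma>"
    unfolding edges_def using arc_point_line by blast
qed

text \<open>The isometry sending the unit vectors to a basis adapted to an antiflag carries the
  standard antiflag to it.\<close>

lemma edge_transitive: "edge_transitive \<Gamma>"
proof -
  let ?a = "Vec e 0 0 0" and ?b = "Vec 0 e 0 0" and ?c = "Vec 0 0 e 0"
  have V: "?a \<in> V" "?b \<in> V" "?c \<in> V" by auto
  have P: "span1 ?c \<in> Points" using V by (intro span1_Points) (auto simp: zero_vec_def)
  have L: "span2 ?a ?b \<in> Lines" using V by (intro span2_in_Lines) (auto simp: zero_vec_def span1_def)
  have "?c \<notin> span2 ?a ?b" by (auto simp: span2_def)
  then have "\<not> span1 ?c \<subseteq> span2 ?a ?b" using mem_span1[OF V(3)] by blast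
  then have "{span1 ?c, span2 ?a ?b} \<in> edges \<Gamma>" using P L by (auto simp: edges_graph)
  then show ?thesis
  proof (rule edge_transitiveI[OF pair_wf_digraph])
    fix d' assume "d' \<in> edges \<Gamma>"
    then obtain P L where PL: "d' = {P, L}" "P \<in> Points" "L \<in> Lines" "\<not> P \<subseteq> L"
      by (auto simp: edges_graph)
    then obtain a b c d where B: "symplectic_basis a b c d" "P = span1 c" "L = span2 a b"
      using antiflag_symplectic_basis by blast
    let ?g = "lin_comb a b c d"
    have g: "isometry ?g" by (rule isometry_lin_comb[OF B(1)])
    have "?g ` span1 ?c = P" "?g ` span2 ?a ?b = L"
      using isometry_image_span1[OF g V(3)] isometry_image_span2[OF g V(1,2)] B lin_comb_standard_basis[OF B(1)]
      by simp_all
    then show "\<exists>f. automorphism \<Gamma> f \<and> f ` {span1 ?c, span2 ?a ?b} = d'"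
      using isometry_automorphism[OF g] PL by (intro exI[of _ "(`) ?g"]) simp
  qed
qed

text \<open>If \<open>f\<close> takes one point to a line, a common neighbour forces it to take
  every point to a line, and then every line to a point. Preserving non-incidence, it preserves
  incidence between the exchanged classes and is a duality.\<close>

lemma not_vertex_transitive:
  assumes "odd q"
  shows "\<not> vertex_transitive \<Gamma>"
proof
  assume "vertex_transitive \<Gamma>"
  moreover have "Points \<noteq> {}" "Lines \<noteq> {}"
    using card_all_Points card_all_Lines by auto
  then obtain P0 L0 where PL: "P0 \<in> Points" "L0 \<in> Lines" by blast
  ultimately obtain f where f: "automorphism \<Gamma> f" "f P0 = L0"
    unfolding vertex_transitive_def by (metis UnI1 UnI2 pverts_graph)
  have bij: "bij_betw f (Points \<union> Lines) (Points \<union> Lines)"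
    and arcs: "\<And>u v. u \<in> Points \<union> Lines \<Longrightarrow> v \<in> Points \<union> Lines \<Longrightarrow> (f u, f v) \<in> parcs \<Gamma> \<longleftrightarrow> (u, v) \<in> parcs \<Gamma>"
    using f by (auto simp: automorphism_def)
  have f_Point: "f P \<in> Lines" if "P \<in> Points" for P
  proof -
    obtain L where L: "L \<in> Lines" "\<not> P0 \<subseteq> L" "\<not> P \<subseteq> L" using ex_line_avoiding[OF PL(1) \<open>P \<in> Points\<close>] by blast
    then have "(f P0, f L) \<in> parcs \<Gamma>" "(f P, f L) \<in> parcs \<Gamma>"
      using that PL by (simp_all add: arcs arc_point_line)
    then have "f L \<in> Points" using f PL by (simp add: arc_line_point)
    then show ?thesis using arcs_sym[OF \<open>(f P, f L) \<in> parcs \<Gamma>\<close>] by (simp add: arc_point_line)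
  qed
  have f_Line: "f L \<in> Points" if "L \<in> Lines" for L
  proof -
    obtain P where "(L, P) \<in> parcs \<Gamma>"
      using neighbourhood_nonempty[of L] \<open>L \<in> Lines\<close> by (auto simp: neighbourhood_def)
    then have P: "P \<in> Points" "(P, L) \<in> parcs \<Gamma>" using that by (simp_all add: arc_line_point arcs_sym)
    then have "(f P, f L) \<in> parcs \<Gamma>" using that by (simp add: arcs)
    then show ?thesis using f_Point[OF P(1)] by (simp add: arc_line_point)
  qed
  have "f ` Points = Lines"
  proof
    \<comment> \<open>The preimage of a line cannot be a line, since lines go to points.\<close>
    show "Lines \<subseteq> f ` Points"
    proof
      fix L assume L: "L \<in> Lines"
      then obtain u where "u \<in> Points \<union> Lines" "f u = L" using bij by (metis UnI2 bij_betw_imp_surj_on imageE)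
      then show "L \<in> f ` Points" using f_Line L disjoint by blast
    qed
  qed (use f_Point in blast)
  moreover have "inj_on f Lines" using bij by (auto simp: bij_betw_def intro: inj_on_subset)
  moreover have "P \<subseteq> L \<longleftrightarrow> f L \<subseteq> f P" if "P \<in> Points" "L \<in> Lines" for P L
  proof -
    have "(f P, f L) \<in> parcs \<Gamma> \<longleftrightarrow> (P, L) \<in> parcs \<Gamma>" using that by (simp add: arcs)
    then show ?thesis using that f_Point f_Line by (simp add: arc_point_line arc_line_point)
  qed
  ultimately show False using no_duality[OF assms, of f] f_Line by blast
qed

lemma ex_semi_symmetric_graph:
  assumes "odd q"
  shows "\<exists>G :: nat pair_pre_digraph. pair_graph G \<and> Digraph_Component.connected (with_proj G) \<and> worthy G \<and>
    semi_symmetric G \<and> card (pverts G) = 2 * (q ^ 3 + q ^ 2 + q + 1) \<and> regular G (q ^ 3 + q ^ 2)"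
proof -
  have "Points \<noteq> {}" using card_all_Points by auto
  then have "pverts \<Gamma> \<noteq> {}" by simp
  from ex_nat_graph[OF pair_graph this reachable_arcs worthy regular edge_transitive not_vertex_transitive[OF assms]]
  show ?thesis unfolding card_vertices .
qed

end

theorem theorem6p2:
  shows "(\<forall>q::nat. primepow q \<and> odd q \<longrightarrow>
            (\<exists>(G :: nat pair_pre_digraph) (n::nat) (d::nat).
               pair_graph G \<and> Digraph_Component.connected (with_proj G) \<and>
               worthy G \<and> semi_symmetric G \<and>
               card (pverts G) = 2 * n \<and> regular G d \<and>
               2 * n = 2 * (q ^ 3 + q ^ 2 + q + 1) \<and> d = q ^ 3 + q ^ 2 \<and>
               real d / real n = (real q ^ 3 + real q ^ 2) / (real q ^ 3 + real q ^ 2 + real q + 1)))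
       \<and> ((\<lambda>q::nat. (real q ^ 3 + real q ^ 2) / (real q ^ 3 + real q ^ 2 + real q + 1))
            \<longlonglongrightarrow> 1)"
proof (intro conjI allI impI)
  fix q :: nat assume q: "primepow q \<and> odd q"
  then obtain F :: "field_product set" and e where F: "finite_subfield F e" "card F = q"
    using ex_finite_subfield by blast
  let ?n = "q ^ 3 + q ^ 2 + q + 1" and ?d = "q ^ 3 + q ^ 2"
  obtain G :: "nat pair_pre_digraph" where
    "pair_graph G \<and> Digraph_Component.connected (with_proj G) \<and> worthy G \<and> semi_symmetric G \<and>
      card (pverts G) = 2 * ?n \<and> regular G ?d"
    using finite_subfield.ex_semi_symmetric_graph[OF F(1)] q unfolding F(2) by blast
  moreover have "real ?d / real ?n = (real q ^ 3 + real q ^ 2) / (real q ^ 3 + real q ^ 2 + real q + 1)"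
    by simp
  ultimately show "\<exists>(G :: nat pair_pre_digraph) n d.
      pair_graph G \<and> Digraph_Component.connected (with_proj G) \<and> worthy G \<and> semi_symmetric G \<and>
      card (pverts G) = 2 * n \<and> regular G d \<and> 2 * n = 2 * ?n \<and> d = ?d \<and>
      real d / real n = (real q ^ 3 + real q ^ 2) / (real q ^ 3 + real q ^ 2 + real q + 1)"
    by blast
next
  show "(\<lambda>q::nat. (real q ^ 3 + real q ^ 2) / (real q ^ 3 + real q ^ 2 + real q + 1)) \<longlonglongrightarrow> 1"
    by real_asymp
qed

end
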